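(* Let $1\le r\le s$, let $A\in\mathbb{C}_r^{m\times n}$ and $\widetilde A=A+E\in\mathbb{C}_s^{m\times n}$ have generalized polar decompositions $A=QH$ and $\widetilde A=\widetilde Q\widetilde H$, and let $\sigma_1\ge\dots\ge\sigma_r>0$ and $\widetilde\sigma_1\ge\dots\ge\widetilde\sigma_s>0$ be the nonzero singular values of $A$ and $\widetilde A$. Then $$\|Q-\widetilde Q\|_F\le \sqrt{\max_{0\le k\le r}\frac{s-r+4k}{\sum_{j=1}^{r-k}(\sigma_j-\widetilde\sigma_j)^2+\sum_{j=1}^{k}(\sigma_{r+1-j}+\widetilde\sigma_{s-k+j})^2+\sum_{j=r-k+1}^{s-k}\widetilde\sigma_j^2}}\;\|E\|_F .$$ Moreover the coefficient of $\|E\|_F$ is optimal: for given $m,n$ and given $\sigma_1\ge\dots\ge\sigma_r>0$, $\widetilde\sigma_1\ge\dots\ge\widetilde\sigma_s>0$ with $s\le\min(m,n)$, it cannot be replaced by any smaller nonnegative number so that the inequality still holds for all $A\in\mathbb{C}_r^{m\times n}$, $\widetilde A\in\mathbb{C}_s^{m\times n}$ with these nonzero singular values.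
   Context: $\mathbb{C}^{m\times n}_r$ denotes the set of complex $m\times n$ matrices of rank $r$; $\|\cdot\|_F$ is the Frobenius norm. For $A\in\mathbb{C}_r^{m\times n}$, the generalized polar decomposition is $A=QH$ with $Q\in\mathbb{C}_r^{m\times n}$ subunitary (a partial isometry) and $H\in\mathbb{C}_r^{n\times n}$ positive semidefinite, subject to $\mathcal R(Q^* )=\mathcal R(H)$ (column spaces), which makes it unique; in fact $H=|A|:=(A^*A)^{1/2}$. $Q$ is the subunitary polar factor and $H$ the positive polar factor. Empty sums are $0$. A quotient of the form $0/0$ (which can occur only for $k=0$, $r=s$ and $\sigma_j=\widetilde\sigma_j$ for all $j$) is read as $0$. *)

theory Defs
  imports
    "HOL-Computational_Algebra.Polynomial"
    "Jordan_Normal_Form.Char_Poly"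
    "Jordan_Normal_Form.Matrix_Kernel"
    "Jordan_Normal_Form.DL_Rank"
    "Jordan_Normal_Form.Schur_Decomposition"
begin

definition rank_mats :: "nat \<Rightarrow> nat \<Rightarrow> nat \<Rightarrow> complex mat set" where
  "rank_mats r m n = {A \<in> carrier_mat m n. vec_space.rank m A = r}"

definition frobenius_norm :: "complex mat \<Rightarrow> real" where
  "frobenius_norm A = sqrt (\<Sum>i<dim_row A. \<Sum>j<dim_col A. (cmod (A $$ (i, j)))\<^sup>2)"

text \<open>Partial isometry: Q preserves the Euclidean norm on the orthogonal complement
  of its kernel. Here \<open>v \<bullet>c v\<close> is the squared Euclidean norm of v.\<close>

definition subunitary :: "complex mat \<Rightarrow> bool" where
  "subunitary Q \<longleftrightarrow>
     (\<forall>x \<in> carrier_vec (dim_col Q).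
        (\<forall>y \<in> mat_kernel Q. x \<bullet>c y = 0) \<longrightarrow> (Q *\<^sub>v x) \<bullet>c (Q *\<^sub>v x) = x \<bullet>c x)"

definition positive_semidefinite :: "complex mat \<Rightarrow> bool" where
  "positive_semidefinite H \<longleftrightarrow>
     square_mat H \<and> mat_adjoint H = H \<and>
     (\<forall>x \<in> carrier_vec (dim_row H). 0 \<le> Re ((H *\<^sub>v x) \<bullet>c x))"

definition generalized_polar_decomposition ::
    "complex mat \<Rightarrow> complex mat \<Rightarrow> complex mat \<Rightarrow> bool" where
  "generalized_polar_decomposition A Q H \<longleftrightarrow>
     (let m = dim_row A; n = dim_col A; r = vec_space.rank m A in
        Q \<in> rank_mats r m n \<and> subunitary Q \<and>
        H \<in> rank_mats r n n \<and> positive_semidefinite H \<and>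
        A = Q * H \<and>
        vec_space.col_space n (mat_adjoint Q) = vec_space.col_space n H)"

text \<open>The singular values are the square roots of the eigenvalues of \<open>A\<^sup>* A\<close>, counted with
  multiplicity. These eigenvalues are real and nonnegative, so \<^const>\<open>Re\<close> only changes the type.\<close>

definition nonzero_singular_values :: "complex mat \<Rightarrow> real multiset" where
  "nonzero_singular_values A =
     filter_mset (\<lambda>x. x \<noteq> 0)
       (image_mset (\<lambda>x. sqrt (Re x)) (proots (char_poly (mat_adjoint A * A))))"

text \<open>Finite sequences are indexed from 1; values outside \<open>{1..r}\<close> are irrelevant.\<close>

definition positive_nonincreasing :: "nat \<Rightarrow> (nat \<Rightarrow> real) \<Rightarrow> bool" where
  "positive_nonincreasing r \<sigma> \<longleftrightarrow>
     (\<forall>j \<in> {1..r}. 0 < \<sigma> j) \<and> (\<forall>i j. 1 \<le> i \<and> i \<le> j \<and> j \<le> r \<longrightarrow> \<sigma> j \<le> \<sigma> i)"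

definition has_nonzero_singular_values :: "complex mat \<Rightarrow> nat \<Rightarrow> (nat \<Rightarrow> real) \<Rightarrow> bool" where
  "has_nonzero_singular_values A r \<sigma> \<longleftrightarrow>
     nonzero_singular_values A = image_mset \<sigma> (mset_set {1..r})"

text \<open>The quotient \<open>0/0\<close>, possible only for \<open>k = 0\<close>, \<open>r = s\<close> and \<open>\<sigma> = \<tau>\<close>, is 0,
  which is also the value of division by zero in HOL. For \<open>r \<le> s\<close> and \<open>k \<le> r\<close> none of
  the subtractions of natural numbers is truncated, and \<open>{r-k+1..s-k}\<close> is empty if \<open>r = s\<close>.\<close>

definition polar_coefficient ::
    "nat \<Rightarrow> nat \<Rightarrow> (nat \<Rightarrow> real) \<Rightarrow> (nat \<Rightarrow> real) \<Rightarrow> real" where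
  "polar_coefficient r s \<sigma> \<tau> =
     sqrt (Max ((\<lambda>k. (real s - real r + 4 * real k) /
              ((\<Sum>j = 1..r-k. (\<sigma> j - \<tau> j)\<^sup>2)
               + (\<Sum>j = 1..k. (\<sigma> (r+1-j) + \<tau> (s-k+j))\<^sup>2)
               + (\<Sum>j = r-k+1..s-k. (\<tau> j)\<^sup>2))) ` {0..r}))"

end

theory Submission
  imports Defs
begin

text \<open>
  Write \<open>A = \<Sum>\<^sub>i \<sigma>\<^sub>i u\<^sub>i v\<^sub>i\<^sup>*\<close> and \<open>A + E = \<Sum>\<^sub>j \<tau>\<^sub>j u'\<^sub>j v'\<^sub>j\<^sup>*\<close> for singular value decompositions. The subunitary
  polar factors are then \<open>Q = \<Sum>\<^sub>i u\<^sub>i v\<^sub>i\<^sup>*\<close> and \<open>Q' = \<Sum>\<^sub>j u'\<^sub>j v'\<^sub>j\<^sup>*\<close>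
  (\<open>polar_decomposition_singular_expansion\<close>, which rests on the spectral theorem
  \<open>hermitian_diagonalization\<close>). With the overlaps \<open>w\<^sub>i\<^sub>j = Re (\<langle>u\<^sub>i, u'\<^sub>j\<rangle> \<langle>v'\<^sub>j, v\<^sub>i\<rangle>)\<close> the squares of both
  sides of the inequality become affine in \<open>w\<close>:
  \<open>\<parallel>Q - Q'\<parallel>\<^sup>2 = r + s - 2 \<Sum> w\<^sub>i\<^sub>j\<close> and \<open>\<parallel>E\<parallel>\<^sup>2 = \<Sum> \<sigma>\<^sub>i\<^sup>2 + \<Sum> \<tau>\<^sub>j\<^sup>2 - 2 \<Sum> \<sigma>\<^sub>i \<tau>\<^sub>j w\<^sub>i\<^sub>j\<close>.
  By the inequalities of Cauchy-Schwarz and Bessel, \<open>\<bar>w\<bar>\<close> has row and column sums at most 1.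

  If \<open>w\<close> is the signed partial permutation matrix that matches the \<open>r - k\<close> largest \<open>\<sigma>\<close> with the
  \<open>r - k\<close> largest \<open>\<tau>\<close> in order, with sign \<open>+\<close>, and the \<open>k\<close> smallest \<open>\<sigma>\<close> with the \<open>k\<close> smallest \<open>\<tau>\<close>
  in opposite order, with sign \<open>-\<close>, then \<open>\<parallel>Q - Q'\<parallel>\<^sup>2 / \<parallel>E\<parallel>\<^sup>2\<close> is exactly the \<open>k\<close>-th quotient in the
  coefficient. The theorem says that these matchings are the worst case.

  Let \<open>M\<close> be the maximum of the quotients. The claim \<open>M \<parallel>E\<parallel>\<^sup>2 - \<parallel>Q - Q'\<parallel>\<^sup>2 \<ge> 0\<close> is a bound for
  \<open>\<Sum> (M \<sigma>\<^sub>i \<tau>\<^sub>j - 1) w\<^sub>i\<^sub>j\<close>. It only gets harder if \<open>\<bar>w\<bar>\<close> is increased until all its row sums are 1 and the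
  sign of every entry is chosen to be that of its coefficient (\<open>substochastic_completion\<close>).
  Let \<open>p\<close> and \<open>n\<close> be the positive and negative parts of the result, and \<open>t\<close> the total mass of \<open>n\<close>. The sum of
  \<open>p - n\<close> over the corner \<open>{1..a} \<times> {1..b}\<close> is at most
  \<open>min {a, b, r - t} - max {0, a + b + t - r - s}\<close>, by counting mass
  (\<open>corner_sum_le_corner_bound\<close>). For integral \<open>t = k\<close> this bound is attained by the signed matching in every
  corner at once (\<open>corner_sum_signed_matching\<close>), and between two consecutive integers it is linear in \<open>t\<close>
  (\<open>corner_bound_interpolates\<close>). As \<open>\<sigma>\<close> and \<open>\<tau>\<close> decrease, domination of corner sums gives domination of
  the sums weighted by \<open>\<sigma>\<^sub>i \<tau>\<^sub>j\<close> (\<open>weighted_double_sum_mono_of_corner_sums_mono\<close>). So the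
  general case follows from a convex combination of two neighbouring matchings
  (\<open>substochastic_ratio_bound\<close>).

  For the optimality, rectangular diagonal matrices realize the matching for an index \<open>k\<close> at which the maximum
  is attained (\<open>polar_factor_perturbation_attained\<close>).
\<close>

section \<open>Double sums with decreasing weights\<close>

text \<open>Abel summation. Passing from \<open>n\<close> to \<open>n + 1\<close> may replace the weight \<open>x n\<close> of the
  nonnegative partial sum by the smaller \<open>x (n + 1)\<close>. The last weight is kept on the left, since the
  next step has to lower it again.\<close>

lemma weighted_sum_ge_of_partial_sums_ge_0:
  fixes x g :: "nat \<Rightarrow> real"
  assumes "\<And>a. a \<in> {1..n} \<Longrightarrow> 0 \<le> (\<Sum>i=1..a. g i)"
    and "\<And>i. 1 \<le> i \<Longrightarrow> i < n \<Longrightarrow> x (Suc i) \<le> x i"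
  shows "x n * (\<Sum>i=1..n. g i) \<le> (\<Sum>i=1..n. x i * g i)"
  using assms
proof (induction n)
  case 0
  then show ?case by simp
next
  case (Suc n)
  have IH: "x n * (\<Sum>i=1..n. g i) \<le> (\<Sum>i=1..n. x i * g i)"
    by (rule Suc.IH) (use Suc.prems in auto)
  have "x (Suc n) * (\<Sum>i=1..n. g i) \<le> x n * (\<Sum>i=1..n. g i)"
  proof (cases "n = 0")
    case False
    then have "x (Suc n) \<le> x n" "0 \<le> (\<Sum>i=1..n. g i)"
      using Suc.prems(1)[of n] Suc.prems(2)[of n] by auto
    then show ?thesis by (rule mult_right_mono)
  qed simp
  with IH show ?case by (simp add: algebra_simps)
qed

lemma weighted_sum_mono_of_partial_sums_mono:
  fixes x p q :: "nat \<Rightarrow> real"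
  assumes "\<And>a. a \<in> {1..n} \<Longrightarrow> (\<Sum>i=1..a. p i) \<le> (\<Sum>i=1..a. q i)"
    and "\<And>i. 1 \<le> i \<Longrightarrow> i < n \<Longrightarrow> x (Suc i) \<le> x i"
    and "\<And>i. i \<in> {1..n} \<Longrightarrow> 0 \<le> x i"
  shows "(\<Sum>i=1..n. x i * p i) \<le> (\<Sum>i=1..n. x i * q i)"
proof (cases "n = 0")
  case False
  have "0 \<le> x n * (\<Sum>i=1..n. q i - p i)"
    using False assms(1)[of n] assms(3)[of n] by (simp add: sum_subtractf)
  also have "\<dots> \<le> (\<Sum>i=1..n. x i * (q i - p i))"
    by (rule weighted_sum_ge_of_partial_sums_ge_0) (use assms in \<open>auto simp: sum_subtractf\<close>)
  finally show ?thesis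
    by (simp add: algebra_simps sum_subtractf)
qed simp

text \<open>The one-dimensional lemma is applied to the rows, and its hypothesis on the partial sums over rows is
  again an instance of the one-dimensional lemma, now for the columns. This is the continuous counterpart of
  the rearrangement inequality: a bound in every corner is what decreasing weights can see.\<close>

lemma weighted_double_sum_mono_of_corner_sums_mono:
  fixes x y :: "nat \<Rightarrow> real" and p q :: "nat \<Rightarrow> nat \<Rightarrow> real"
  assumes corner: "\<And>a b. a \<in> {1..r} \<Longrightarrow> b \<in> {1..s} \<Longrightarrow>
      (\<Sum>i=1..a. \<Sum>j=1..b. p i j) \<le> (\<Sum>i=1..a. \<Sum>j=1..b. q i j)"
    and x: "\<And>i. 1 \<le> i \<Longrightarrow> i < r \<Longrightarrow> x (Suc i) \<le> x i" "\<And>i. i \<in> {1..r} \<Longrightarrow> 0 \<le> x i"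
    and y: "\<And>j. 1 \<le> j \<Longrightarrow> j < s \<Longrightarrow> y (Suc j) \<le> y j" "\<And>j. j \<in> {1..s} \<Longrightarrow> 0 \<le> y j"
  shows "(\<Sum>i=1..r. \<Sum>j=1..s. x i * y j * p i j) \<le> (\<Sum>i=1..r. \<Sum>j=1..s. x i * y j * q i j)"
proof -
  have "(\<Sum>i=1..r. x i * (\<Sum>j=1..s. y j * p i j)) \<le> (\<Sum>i=1..r. x i * (\<Sum>j=1..s. y j * q i j))"
  proof (rule weighted_sum_mono_of_partial_sums_mono)
    fix a assume a: "a \<in> {1..r}"
    have swap: "(\<Sum>i=1..a. \<Sum>j=1..s. y j * f i j) = (\<Sum>j=1..s. y j * (\<Sum>i=1..a. f i j))" for f
      by (subst sum.swap) (simp add: sum_distrib_left)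
    show "(\<Sum>i=1..a. \<Sum>j=1..s. y j * p i j) \<le> (\<Sum>i=1..a. \<Sum>j=1..s. y j * q i j)"
      unfolding swap
    proof (rule weighted_sum_mono_of_partial_sums_mono)
      fix b assume "b \<in> {1..s}"
      then show "(\<Sum>j=1..b. \<Sum>i=1..a. p i j) \<le> (\<Sum>j=1..b. \<Sum>i=1..a. q i j)"
        using corner[OF a, of b] by (simp only: sum.swap[of _ "{1..b}" "{1..a}"])
    qed (use y in auto)
  qed (use x in auto)
  then show ?thesis by (simp add: sum_distrib_left mult.assoc)
qed

section \<open>Doubly substochastic matrices and signed matchings\<close>

text \<open>The missing mass of row \<open>i\<close> is spread over the columns in proportion to what these still
  can take. The missing mass of all columns together is at least that of all rows, as there are at least as many
  columns as rows, so no column overflows.\<close>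

lemma substochastic_completion:
  fixes w :: "'i \<Rightarrow> 'j \<Rightarrow> real"
  assumes fin: "finite I" "finite J" and card: "card I \<le> card J"
    and nonneg: "\<And>i j. i \<in> I \<Longrightarrow> j \<in> J \<Longrightarrow> 0 \<le> w i j"
    and row: "\<And>i. i \<in> I \<Longrightarrow> (\<Sum>j\<in>J. w i j) \<le> 1"
    and col: "\<And>j. j \<in> J \<Longrightarrow> (\<Sum>i\<in>I. w i j) \<le> 1"
  obtains w' where "\<And>i j. i \<in> I \<Longrightarrow> j \<in> J \<Longrightarrow> w i j \<le> w' i j"
    "\<And>i. i \<in> I \<Longrightarrow> (\<Sum>j\<in>J. w' i j) = 1"
    "\<And>j. j \<in> J \<Longrightarrow> (\<Sum>i\<in>I. w' i j) \<le> 1"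
proof -
  define R where "R i = (\<Sum>j\<in>J. w i j)" for i
  define C where "C j = (\<Sum>i\<in>I. w i j)" for j
  define T where "T = (\<Sum>i\<in>I. R i)"
  have TC: "T = (\<Sum>j\<in>J. C j)"
    unfolding T_def R_def C_def by (rule sum.swap)
  have sR: "(\<Sum>i\<in>I. 1 - R i) = card I - T" and sC: "(\<Sum>j\<in>J. 1 - C j) = card J - T"
    by (simp_all add: sum_subtractf T_def TC[unfolded T_def])
  have R1: "R i \<le> 1" if "i \<in> I" for i using row that by (simp add: R_def)
  have C1: "C j \<le> 1" if "j \<in> J" for j using col that by (simp add: C_def)
  have "0 \<le> (\<Sum>i\<in>I. 1 - R i)" using R1 by (intro sum_nonneg) auto
  then have IT: "0 \<le> real (card I) - T" using sR by simp
  \<comment> \<open>If the columns are already full, then so are the rows, and the quotient 0/0 = 0 adds nothing.\<close>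
  define w' where "w' i j = w i j + (1 - R i) * (1 - C j) / (card J - T)" for i j
  show thesis
  proof
    fix i j assume "i \<in> I" "j \<in> J"
    then show "w i j \<le> w' i j"
      using R1 C1 IT card by (simp add: w'_def)
  next
    fix i assume i: "i \<in> I"
    have "(\<Sum>j\<in>J. w' i j) = R i + (1 - R i) * (card J - T) / (card J - T)"
      unfolding w'_def sum.distrib R_def[symmetric] sC[symmetric]
      by (simp add: sum_distrib_left sum_divide_distrib)
    also have "\<dots> = 1"
    proof (cases "card J - T = 0")
      case True
      then have "(\<Sum>i\<in>I. 1 - R i) = 0" using IT card sR by simp
      then have "1 - R i = 0"
        using sum_nonneg_eq_0_iff[of I "\<lambda>i. 1 - R i"] fin(1) R1 i by auto
      then show ?thesis using True by simp
    qed simp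
    finally show "(\<Sum>j\<in>J. w' i j) = 1" .
  next
    fix j assume j: "j \<in> J"
    have "(\<Sum>i\<in>I. w' i j) = C j + (1 - C j) * ((card I - T) / (card J - T))"
      unfolding w'_def sum.distrib C_def[symmetric] sR[symmetric]
      by (simp add: sum_distrib_left sum_divide_distrib mult.commute)
    also have "\<dots> \<le> C j + (1 - C j) * 1"
      by (intro add_left_mono mult_left_mono)
        (use C1[OF j] IT card in \<open>auto simp: divide_le_eq\<close>)
    finally show "(\<Sum>i\<in>I. w' i j) \<le> 1" by simp
  qed
qed

text \<open>The signed partial permutation matrix behind the \<open>k\<close>-th quotient. The last \<open>k\<close> rows
  are matched antidiagonally with the last \<open>k\<close> columns: \<open>i = r + 1 - l\<close> and \<open>j = s - k + l\<close>
  have the sum \<open>r + s + 1 - k\<close>.\<close>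

definition signed_matching :: "nat \<Rightarrow> nat \<Rightarrow> nat \<Rightarrow> nat \<Rightarrow> nat \<Rightarrow> real" where
  "signed_matching r s k i j =
     (if i \<le> r - k then of_bool (j = i) else - of_bool (i + j = r + s + 1 - k))"

text \<open>The largest possible sum over the corner \<open>{1..a} \<times> {1..b}\<close> for a signed doubly substochastic
  matrix with row sums 1 in absolute value and negative mass \<open>t\<close>. The real parameter \<open>t\<close>
  interpolates between the matchings.\<close>

definition corner_bound :: "nat \<Rightarrow> nat \<Rightarrow> real \<Rightarrow> nat \<Rightarrow> nat \<Rightarrow> real" where
  "corner_bound r s t a b = min (real (min a b)) (r - t) - max 0 (real a + real b + t - r - s)"

lemma sum_signed_matching:
  assumes "r \<le> s" "k \<le> r" "a \<le> r"
  shows "(\<Sum>i=1..a. \<Sum>j=1..b. signed_matching r s k i j * z i j) =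
    (\<Sum>i\<in>{i\<in>{1..a}. i \<le> r - k \<and> i \<le> b}. z i i) -
    (\<Sum>i\<in>{i\<in>{1..a}. r - k < i \<and> r + s + 1 - k - i \<le> b}. z i (r + s + 1 - k - i))"
proof -
  have "(\<Sum>j=1..b. signed_matching r s k i j * z i j) =
     (if i \<le> r - k \<and> i \<le> b then z i i else 0) -
     (if r - k < i \<and> r + s + 1 - k - i \<le> b then z i (r + s + 1 - k - i) else 0)"
    if i: "i \<in> {1..a}" for i
  proof (cases "i \<le> r - k")
    case True
    then have "(\<Sum>j=1..b. signed_matching r s k i j * z i j) = (\<Sum>j=1..b. if j = i then z i j else 0)"
      by (intro sum.cong) (auto simp: signed_matching_def)
    also have "\<dots> = (if i \<le> b then z i i else 0)"
      using i by (simp add: sum.delta)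
    finally show ?thesis using True by auto
  next
    case False
    then have "(\<Sum>j=1..b. signed_matching r s k i j * z i j)
        = (\<Sum>j=1..b. if j = r + s + 1 - k - i then - z i j else 0)"
      using assms i by (intro sum.cong) (auto simp: signed_matching_def)
    also have "\<dots> = (if r + s + 1 - k - i \<le> b then - z i (r + s + 1 - k - i) else 0)"
      using i assms by (auto simp: sum.delta)
    finally show ?thesis using False by auto
  qed
  then have "(\<Sum>i=1..a. \<Sum>j=1..b. signed_matching r s k i j * z i j) =
    (\<Sum>i=1..a. (if i \<le> r - k \<and> i \<le> b then z i i else 0) -
     (if r - k < i \<and> r + s + 1 - k - i \<le> b then z i (r + s + 1 - k - i) else 0))"
    by (intro sum.cong) auto
  then show ?thesis
    unfolding sum.inter_filter[OF finite_atLeastAtMost] sum_subtractf .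
qed

text \<open>In every corner the matching has as many positive entries as the row, column and mass constraints
  permit, and only those negative entries that do not fit outside the corner.\<close>

lemma corner_sum_signed_matching:
  assumes "r \<le> s" "k \<le> r" "a \<le> r" "b \<le> s"
  shows "(\<Sum>i=1..a. \<Sum>j=1..b. signed_matching r s k i j) = corner_bound r s (real k) a b"
proof -
  have 1: "{i\<in>{1..a}. i \<le> r - k \<and> i \<le> b} = {1..min (min a b) (r - k)}" by auto
  have 2: "{i\<in>{1..a}. r - k < i \<and> r + s + 1 - k - i \<le> b} = {r + s + 1 - k - b..a}"
    using assms by auto
  show ?thesis
    using sum_signed_matching[OF assms(1-3), where z = "\<lambda>i j. 1" and b = b] assms
    unfolding 1 2 corner_bound_def by (auto simp: of_nat_diff min_def max_def)
qed

lemma weighted_sum_signed_matching: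
  fixes x y :: "nat \<Rightarrow> real"
  assumes "r \<le> s" "k \<le> r"
  shows "(\<Sum>i=1..r. \<Sum>j=1..s. x i * y j * signed_matching r s k i j) =
    (\<Sum>j=1..r-k. x j * y j) - (\<Sum>j=1..k. x (r + 1 - j) * y (s - k + j))"
proof -
  have 1: "{i\<in>{1..r}. i \<le> r - k \<and> i \<le> s} = {1..r - k}" using assms by auto
  have 2: "{i\<in>{1..r}. r - k < i \<and> r + s + 1 - k - i \<le> s} = {r - k + 1..r}"
    using assms by auto
  have 3: "(\<Sum>i=r-k+1..r. x i * y (r + s + 1 - k - i)) = (\<Sum>j=1..k. x (r + 1 - j) * y (s - k + j))"
    by (rule sum.reindex_bij_witness[of _ "\<lambda>j. r + 1 - j" "\<lambda>i. r + 1 - i"])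
      (use assms in \<open>auto intro!: arg_cong2[where f = "(*)"] arg_cong[where f = y]\<close>)
  show ?thesis
    using sum_signed_matching[OF assms order_refl, where z = "\<lambda>i j. x i * y j" and b = s]
    unfolding 1 2 3 by (simp add: mult.commute mult.left_commute)
qed

text \<open>All kinks of the bound, as a function of \<open>t\<close>, are at integers.\<close>

lemma corner_bound_interpolates:
  assumes "r \<le> s" "real k \<le> t" "t \<le> real k + 1" "k + 1 \<le> r"
  shows "corner_bound r s t a b =
    (1 - (t - k)) * corner_bound r s (real k) a b + (t - k) * corner_bound r s (real (k + 1)) a b"
proof -
  have 1: "min (real c) (r - t) = (1 - (t - k)) * min (real c) (r - real k) + (t - k) * min (real c) (r - real (k + 1))" for c
  proof (cases "c + k + 1 \<le> r")
    case True
    then have "real c + k + 1 \<le> r" by linarith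
    then show ?thesis using assms by (simp add: min_def algebra_simps)
  next
    case False
    then have "real c + k \<ge> r" by linarith
    then have "min (real c) (r - t) = r - t" "min (real c) (r - real k) = r - real k"
      "min (real c) (r - real (k + 1)) = r - real (k + 1)" using assms by auto
    then show ?thesis by (simp add: algebra_simps)
  qed
  have 2: "max 0 (real a + real b + t - r - s) = (1 - (t - k)) * max 0 (real a + real b + real k - r - s)
     + (t - k) * max 0 (real a + real b + real (k + 1) - r - s)"
  proof (cases "a + b + k + 1 \<le> r + s")
    case True
    then have "real a + b + k + 1 \<le> real r + s" by linarith
    then have "max 0 (real a + real b + t - r - s) = 0" "max 0 (real a + real b + real k - r - s) = 0"
      "max 0 (real a + real b + real (k + 1) - r - s) = 0" using assms by auto
    then show ?thesis by simp
  next
    case False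
    then have "real a + b + k \<ge> real r + s" by linarith
    then have "max 0 (real a + real b + t - r - s) = real a + real b + t - r - s"
      "max 0 (real a + real b + real k - r - s) = real a + real b + real k - r - s"
      "max 0 (real a + real b + real (k + 1) - r - s) = real a + real b + real (k + 1) - r - s" using assms by auto
    then show ?thesis by (simp add: algebra_simps)
  qed
  show ?thesis
    unfolding corner_bound_def 1 2 by (simp add: algebra_simps)
qed

text \<open>The positive part of the corner is bounded by the number of rows, the number of columns and the total
  positive mass. Of the negative mass \<open>t\<close>, at most \<open>r - a\<close> lies in the rows below the
  corner and at most \<open>s - b\<close> in the columns to the right of it; the rest lies in the corner.\<close>

lemma corner_sum_le_corner_bound:
  fixes p n :: "nat \<Rightarrow> nat \<Rightarrow> real"
  assumes nonneg: "\<And>i j. i \<in> {1..r} \<Longrightarrow> j \<in> {1..s} \<Longrightarrow> 0 \<le> p i j \<and> 0 \<le> n i j"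
    and row: "\<And>i. i \<in> {1..r} \<Longrightarrow> (\<Sum>j=1..s. p i j + n i j) = 1"
    and col: "\<And>j. j \<in> {1..s} \<Longrightarrow> (\<Sum>i=1..r. p i j + n i j) \<le> 1"
    and t: "t = (\<Sum>i=1..r. \<Sum>j=1..s. n i j)"
    and a: "a \<le> r" and b: "b \<le> s"
  shows "(\<Sum>i=1..a. \<Sum>j=1..b. p i j - n i j) \<le> corner_bound r s t a b"
proof -
  let ?P = "\<lambda>I J. \<Sum>i\<in>I. \<Sum>j\<in>J. p i j" and ?N = "\<lambda>I J. \<Sum>i\<in>I. \<Sum>j\<in>J. n i j"
  have sub: "{1..a} \<subseteq> {1..r}" "{1..b} \<subseteq> {1..s}" using a b by auto
  have rows: "?P I J + ?N I J \<le> card I" if "I \<subseteq> {1..r}" "J \<subseteq> {1..s}" for I J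
  proof -
    have "?P I J + ?N I J = (\<Sum>i\<in>I. \<Sum>j\<in>J. p i j + n i j)" by (simp add: sum.distrib)
    also have "\<dots> \<le> (\<Sum>i\<in>I. \<Sum>j=1..s. p i j + n i j)"
      using that nonneg by (intro sum_mono sum_mono2) (auto 0 4 intro!: add_nonneg_nonneg)
    also have "\<dots> = (\<Sum>i\<in>I. 1)" using that row by (intro sum.cong) auto
    finally show ?thesis by simp
  qed
  have cols: "?P I J + ?N I J \<le> card J" if "I \<subseteq> {1..r}" "J \<subseteq> {1..s}" for I J
  proof -
    have "?P I J + ?N I J = (\<Sum>j\<in>J. \<Sum>i\<in>I. p i j + n i j)"
      by (simp add: sum.distrib sum.swap[of _ I J])
    also have "\<dots> \<le> (\<Sum>j\<in>J. \<Sum>i=1..r. p i j + n i j)"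
      using that nonneg by (intro sum_mono sum_mono2) (auto 0 4 intro!: add_nonneg_nonneg)
    also have "\<dots> \<le> (\<Sum>j\<in>J. 1)" using that col by (intro sum_mono) auto
    finally show ?thesis by simp
  qed
  have P0: "0 \<le> ?P I J" and N0: "0 \<le> ?N I J" if "I \<subseteq> {1..r}" "J \<subseteq> {1..s}" for I J
    using that nonneg by (auto 0 4 intro!: sum_nonneg)
  have "?P {1..r} {1..s} + ?N {1..r} {1..s} = (\<Sum>i=1..r. \<Sum>j=1..s. p i j + n i j)"
    by (simp add: sum.distrib)
  also have "\<dots> = r" using row by simp
  finally have tot: "?P {1..r} {1..s} = r - t" using t by simp
  have "?P {1..a} {1..b} \<le> ?P {1..r} {1..b}"
    by (rule sum_mono2) (use a b nonneg in \<open>auto 0 4 intro!: sum_nonneg\<close>)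
  also have "\<dots> \<le> ?P {1..r} {1..s}"
    by (intro sum_mono sum_mono2) (use a b nonneg in auto)
  finally have P3: "?P {1..a} {1..b} \<le> r - t" using tot by simp
  have P12: "?P {1..a} {1..b} \<le> a" "?P {1..a} {1..b} \<le> b"
    using rows[OF sub] cols[OF sub] N0[OF sub] by auto
  have d: "?N {1..r} {1..s} = ?N {1..a} {1..b} + ?N {1..a} {b+1..s} + ?N {a+1..r} {1..s}"
  proof -
    have "{1..r} = {1..a} \<union> {a+1..r}" "{1..s} = {1..b} \<union> {b+1..s}" using a b by auto
    then show ?thesis by (simp add: sum.union_disjoint sum.distrib)
  qed
  have "?N {1..a} {b+1..s} \<le> s - b"
    using cols[of "{1..a}" "{b+1..s}"] P0[of "{1..a}" "{b+1..s}"] a b by auto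
  moreover have "?N {a+1..r} {1..s} \<le> r - a"
    using rows[of "{a+1..r}" "{1..s}"] P0[of "{a+1..r}" "{1..s}"] a b by auto
  ultimately have "real a + real b + t - r - s \<le> ?N {1..a} {1..b}"
    using d t a b by (simp add: of_nat_diff)
  then have "max 0 (real a + real b + t - r - s) \<le> ?N {1..a} {1..b}" using N0[OF sub] by simp
  moreover have "?P {1..a} {1..b} \<le> min (real (min a b)) (r - t)" using P3 P12 by simp
  ultimately show ?thesis unfolding corner_bound_def sum_subtractf by (rule diff_mono[rotated])
qed

text \<open>The value of \<open>\<parallel>E\<parallel>\<^sup>2\<close> when the singular vectors are paired according to
  the \<open>k\<close>-th signed matching; it is the \<open>k\<close>-th denominator in the coefficient.\<close>

definition matching_distance :: "nat \<Rightarrow> nat \<Rightarrow> (nat \<Rightarrow> real) \<Rightarrow> (nat \<Rightarrow> real) \<Rightarrow> nat \<Rightarrow> real" where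
  "matching_distance r s x y k =
     (\<Sum>j = 1..r-k. (x j - y j)\<^sup>2) + (\<Sum>j = 1..k. (x (r+1-j) + y (s-k+j))\<^sup>2)
     + (\<Sum>j = r-k+1..s-k. (y j)\<^sup>2)"

lemma matching_distance_eq:
  assumes "r \<le> s" "k \<le> r"
  shows "matching_distance r s x y k = (\<Sum>i=1..r. (x i)\<^sup>2) + (\<Sum>j=1..s. (y j)\<^sup>2)
    - 2 * (\<Sum>i=1..r. \<Sum>j=1..s. x i * y j * signed_matching r s k i j)"
proof -
  have "{1..r} = {1..r-k} \<union> {r-k+1..r}" using assms by auto
  then have "(\<Sum>i=1..r. (x i)\<^sup>2) = (\<Sum>i=1..r-k. (x i)\<^sup>2) + (\<Sum>i=r-k+1..r. (x i)\<^sup>2)"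
    by (simp add: sum.union_disjoint)
  also have "(\<Sum>i=r-k+1..r. (x i)\<^sup>2) = (\<Sum>j=1..k. (x (r+1-j))\<^sup>2)"
    by (rule sum.reindex_bij_witness[of _ "\<lambda>j. r + 1 - j" "\<lambda>i. r + 1 - i"]) (use assms in auto)
  finally have X: "(\<Sum>i=1..r. (x i)\<^sup>2) = (\<Sum>i=1..r-k. (x i)\<^sup>2) + (\<Sum>j=1..k. (x (r+1-j))\<^sup>2)" .
  have "{1..s} = {1..r-k} \<union> {r-k+1..s-k} \<union> {s-k+1..s}" using assms by auto
  then have "(\<Sum>i=1..s. (y i)\<^sup>2) = (\<Sum>i=1..r-k. (y i)\<^sup>2) + (\<Sum>i=r-k+1..s-k. (y i)\<^sup>2) + (\<Sum>i=s-k+1..s. (y i)\<^sup>2)"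
    using assms by (simp only:) (subst sum.union_disjoint, force, force, force, simp add: sum.union_disjoint)
  also have "(\<Sum>i=s-k+1..s. (y i)\<^sup>2) = (\<Sum>j=1..k. (y (s-k+j))\<^sup>2)"
    by (rule sum.reindex_bij_witness[of _ "\<lambda>j. s - k + j" "\<lambda>i. i - (s - k)"]) (use assms in auto)
  finally have Y: "(\<Sum>i=1..s. (y i)\<^sup>2) = (\<Sum>i=1..r-k. (y i)\<^sup>2) + (\<Sum>i=r-k+1..s-k. (y i)\<^sup>2) + (\<Sum>j=1..k. (y (s-k+j))\<^sup>2)" .
  show ?thesis
    unfolding X Y weighted_sum_signed_matching[OF assms] matching_distance_def
    by (simp add: power2_sum power2_diff sum.distrib sum_subtractf sum_distrib_left algebra_simps)
qed

text \<open>The combinatorial core. The left-hand side is \<open>\<parallel>Q - Q'\<parallel>\<^sup>2\<close>, and the factor of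
  \<open>M\<close> is \<open>\<parallel>E\<parallel>\<^sup>2\<close>, for an arbitrary matrix \<open>w\<close> of overlaps; the assumption on
  \<open>M\<close> is the same inequality for the signed matchings.\<close>

lemma substochastic_ratio_bound:
  fixes x y :: "nat \<Rightarrow> real" and w :: "nat \<Rightarrow> nat \<Rightarrow> real"
  assumes r: "1 \<le> r" "r \<le> s"
    and x: "\<And>i. 1 \<le> i \<Longrightarrow> i < r \<Longrightarrow> x (Suc i) \<le> x i" "\<And>i. i \<in> {1..r} \<Longrightarrow> 0 \<le> x i"
    and y: "\<And>j. 1 \<le> j \<Longrightarrow> j < s \<Longrightarrow> y (Suc j) \<le> y j" "\<And>j. j \<in> {1..s} \<Longrightarrow> 0 \<le> y j"
    and row: "\<And>i. i \<in> {1..r} \<Longrightarrow> (\<Sum>j=1..s. \<bar>w i j\<bar>) \<le> 1"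
    and col: "\<And>j. j \<in> {1..s} \<Longrightarrow> (\<Sum>i=1..r. \<bar>w i j\<bar>) \<le> 1"
    and M: "0 \<le> M" "\<And>k. k \<le> r \<Longrightarrow> real s - real r + 4 * real k \<le> M * matching_distance r s x y k"
  shows "real r + real s - 2 * (\<Sum>i=1..r. \<Sum>j=1..s. w i j)
    \<le> M * ((\<Sum>i=1..r. (x i)\<^sup>2) + (\<Sum>j=1..s. (y j)\<^sup>2) - 2 * (\<Sum>i=1..r. \<Sum>j=1..s. x i * y j * w i j))"
proof -
  define c where "c i j = M * (x i * y j) - 1" for i j
  obtain w' where w': "\<And>i j. i \<in> {1..r} \<Longrightarrow> j \<in> {1..s} \<Longrightarrow> \<bar>w i j\<bar> \<le> w' i j"
    "\<And>i. i \<in> {1..r} \<Longrightarrow> (\<Sum>j=1..s. w' i j) = 1"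
    "\<And>j. j \<in> {1..s} \<Longrightarrow> (\<Sum>i=1..r. w' i j) \<le> 1"
    by (rule substochastic_completion[of "{1..r}" "{1..s}" "\<lambda>i j. \<bar>w i j\<bar>"]) (use r row col in auto)
  have w'0: "0 \<le> w' i j" if "i \<in> {1..r}" "j \<in> {1..s}" for i j
    using w'(1)[OF that] by linarith
  \<comment> \<open>Giving every entry the sign of its coefficient makes the sum as large as possible.\<close>
  define p where "p i j = (if 0 \<le> c i j then w' i j else 0)" for i j
  define n where "n i j = (if 0 \<le> c i j then 0 else w' i j)" for i j
  have pn: "p i j + n i j = w' i j" for i j by (simp add: p_def n_def)
  define t where "t = (\<Sum>i=1..r. \<Sum>j=1..s. n i j)"
  have t0: "0 \<le> t" unfolding t_def using w'0 by (auto intro!: sum_nonneg simp: n_def)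
  have tot: "(\<Sum>i=1..r. \<Sum>j=1..s. p i j) + t = r"
    unfolding t_def sum.distrib[symmetric] pn using w'(2) by simp
  have p0: "0 \<le> (\<Sum>i=1..r. \<Sum>j=1..s. p i j)" using w'0 by (auto intro!: sum_nonneg simp: p_def)
  \<comment> \<open>At the endpoint t = r the floor of t is one too large, as k + 1 has to stay within range.\<close>
  obtain k where k: "real k \<le> t" "t \<le> real k + 1" "k + 1 \<le> r"
  proof (cases "t = r")
    case True
    then show thesis using that[of "r - 1"] r by simp
  next
    case False
    then have "t < r" using tot p0 by simp
    then show thesis using that[of "nat \<lfloor>t\<rfloor>"] t0 by linarith
  qed
  define \<theta> where "\<theta> = t - k"
  define S where "S k = (\<Sum>i=1..r. \<Sum>j=1..s. x i * y j * signed_matching r s k i j)" for k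
  define q where "q i j = (1 - \<theta>) * signed_matching r s k i j + \<theta> * signed_matching r s (k + 1) i j" for i j
  have "(\<Sum>i=1..r. \<Sum>j=1..s. x i * y j * (p i j - n i j)) \<le> (\<Sum>i=1..r. \<Sum>j=1..s. x i * y j * q i j)"
  proof (rule weighted_double_sum_mono_of_corner_sums_mono)
    fix a b assume ab: "a \<in> {1..r}" "b \<in> {1..s}"
    have "(\<Sum>i=1..a. \<Sum>j=1..b. p i j - n i j) \<le> corner_bound r s t a b"
      by (rule corner_sum_le_corner_bound)
        (use ab w'(2,3) w'0 pn t_def in \<open>auto simp: p_def n_def\<close>)
    also have "\<dots> = (\<Sum>i=1..a. \<Sum>j=1..b. q i j)"
      using ab k r
      by (simp add: q_def sum.distrib corner_bound_interpolates[OF r(2) k] \<theta>_def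
          corner_sum_signed_matching[symmetric] sum_distrib_left del: of_nat_add of_nat_Suc)
    finally show "(\<Sum>i=1..a. \<Sum>j=1..b. p i j - n i j) \<le> (\<Sum>i=1..a. \<Sum>j=1..b. q i j)" .
  qed (use x y in auto)
  also have "\<dots> = (1 - \<theta>) * S k + \<theta> * S (k + 1)"
    unfolding S_def q_def sum_distrib_left sum.distrib[symmetric]
    by (intro sum.cong refl) (simp add: algebra_simps)
  finally have main: "(\<Sum>i=1..r. \<Sum>j=1..s. x i * y j * (p i j - n i j)) \<le> (1 - \<theta>) * S k + \<theta> * S (k + 1)" .
  have "(\<Sum>i=1..r. \<Sum>j=1..s. c i j * w i j) \<le> (\<Sum>i=1..r. \<Sum>j=1..s. c i j * (p i j - n i j))"
  proof (intro sum_mono)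
    fix i j assume ij: "i \<in> {1..r}" "j \<in> {1..s}"
    have "c i j * w i j \<le> \<bar>c i j\<bar> * \<bar>w i j\<bar>" by (metis abs_ge_self abs_mult)
    also have "\<dots> \<le> \<bar>c i j\<bar> * w' i j" using w'(1)[OF ij] by (rule mult_left_mono) simp
    also have "\<dots> = c i j * (p i j - n i j)" by (simp add: p_def n_def)
    finally show "c i j * w i j \<le> c i j * (p i j - n i j)" .
  qed
  also have "\<dots> = M * (\<Sum>i=1..r. \<Sum>j=1..s. x i * y j * (p i j - n i j)) - (r - 2 * t)"
  proof -
    have "(\<Sum>i=1..r. \<Sum>j=1..s. c i j * (p i j - n i j))
      = M * (\<Sum>i=1..r. \<Sum>j=1..s. x i * y j * (p i j - n i j))
        - ((\<Sum>i=1..r. \<Sum>j=1..s. p i j) - (\<Sum>i=1..r. \<Sum>j=1..s. n i j))"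
      unfolding c_def sum_distrib_left sum_subtractf[symmetric]
      by (intro sum.cong refl) (simp add: algebra_simps)
    then show ?thesis using tot t_def by simp
  qed
  also have "\<dots> \<le> M * ((1 - \<theta>) * S k + \<theta> * S (k + 1)) - (r - 2 * t)"
    using mult_left_mono[OF main M(1)] by simp
  finally have 1: "(\<Sum>i=1..r. \<Sum>j=1..s. c i j * w i j) \<le> M * ((1 - \<theta>) * S k + \<theta> * S (k + 1)) - (r - 2 * t)" .
  define C where "C = (\<Sum>i=1..r. (x i)\<^sup>2) + (\<Sum>j=1..s. (y j)\<^sup>2)"
  have Mk: "real s - real r + 4 * real l \<le> M * (C - 2 * S l)" if "l \<le> r" for l
    using M(2)[OF that] unfolding matching_distance_eq[OF r(2) that] C_def S_def .
  have "(1 - \<theta>) * (real s - real r + 4 * real k) \<le> (1 - \<theta>) * (M * (C - 2 * S k))"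
    using Mk[of k] k by (intro mult_left_mono) (auto simp: \<theta>_def)
  moreover have "\<theta> * (real s - real r + 4 * real (k + 1)) \<le> \<theta> * (M * (C - 2 * S (k + 1)))"
    using Mk[of "k + 1"] k by (intro mult_left_mono) (auto simp: \<theta>_def)
  ultimately have "real s - real r + 4 * (k + \<theta>) \<le> M * (C - 2 * ((1 - \<theta>) * S k + \<theta> * S (k + 1)))"
    by (simp add: algebra_simps)
  then have 2: "real s - real r + 4 * t \<le> M * C - 2 * (M * ((1 - \<theta>) * S k + \<theta> * S (k + 1)))"
    by (simp add: \<theta>_def algebra_simps)
  have "(\<Sum>i=1..r. \<Sum>j=1..s. c i j * w i j) =
     M * (\<Sum>i=1..r. \<Sum>j=1..s. x i * y j * w i j) - (\<Sum>i=1..r. \<Sum>j=1..s. w i j)"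
    unfolding c_def by (simp add: sum_distrib_left sum_subtractf algebra_simps)
  with 1 2 show ?thesis unfolding C_def[symmetric] by (simp add: algebra_simps)
qed

section \<open>Unitary diagonalization of Hermitian matrices\<close>

lemma mat_adjoint_dims [simp]:
  "dim_row (mat_adjoint A) = dim_col A" "dim_col (mat_adjoint A) = dim_row A"
  by (simp_all add: mat_adjoint_def)

lemma mat_adjoint_carrier [simp]: "A \<in> carrier_mat m n \<Longrightarrow> mat_adjoint A \<in> carrier_mat n m"
  by (metis carrier_matD carrier_matI mat_adjoint_dims)

lemma mat_adjoint_index [simp]:
  "i < dim_col A \<Longrightarrow> j < dim_row A \<Longrightarrow> mat_adjoint A $$ (i, j) = conjugate (A $$ (j, i))"
  by (simp add: mat_adjoint_def mat_of_rows_index)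

lemma mat_adjoint_adjoint [simp]: "mat_adjoint (mat_adjoint (A :: complex mat)) = A"
  by (rule eq_matI) auto

lemma mat_adjoint_mult:
  fixes A B :: "complex mat"
  assumes "A \<in> carrier_mat m n" "B \<in> carrier_mat n k"
  shows "mat_adjoint (A * B) = mat_adjoint B * mat_adjoint A"
  using assms by (intro eq_matI) (auto simp: scalar_prod_def mult.commute)

lemma cscalar_prod_mult_mat_vec:
  fixes A :: "complex mat"
  assumes "A \<in> carrier_mat m n" "x \<in> carrier_vec n" "y \<in> carrier_vec m"
  shows "(A *\<^sub>v x) \<bullet>c y = x \<bullet>c (mat_adjoint A *\<^sub>v y)"
proof -
  have "(A *\<^sub>v x) \<bullet>c y = (\<Sum>i<m. \<Sum>j<n. A $$ (i,j) * x $ j * cnj (y $ i))"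
    using assms by (simp add: scalar_prod_def sum_distrib_right atLeast0LessThan)
  also have "\<dots> = (\<Sum>j<n. \<Sum>i<m. A $$ (i,j) * x $ j * cnj (y $ i))"
    by (rule sum.swap)
  also have "\<dots> = x \<bullet>c (mat_adjoint A *\<^sub>v y)"
    using assms by (simp add: scalar_prod_def sum_distrib_left sum_distrib_right atLeast0LessThan mult_ac)
  finally show ?thesis .
qed

lemma cscalar_prod_self: 
  fixes x :: "complex vec"
  shows "x \<bullet>c x = complex_of_real (\<Sum>i<dim_vec x. (cmod (x $ i))\<^sup>2)"
  by (simp add: scalar_prod_def atLeast0LessThan complex_norm_square del: of_real_power)

text \<open>Gram-Schmidt keeps the first vector of the basis that completes \<open>v\<close>; only the lengths
  have to be normalized, which is where the scalar \<open>c\<close> comes from.\<close>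

lemma exists_unitary_with_first_col:
  fixes v :: "complex vec"
  assumes v: "v \<in> carrier_vec n" "v \<noteq> 0\<^sub>v n"
  obtains W c where "W \<in> carrier_mat n n" "mat_adjoint W * W = 1\<^sub>m n" "col W 0 = c \<cdot>\<^sub>v v"
proof -
  interpret cof_vec_space n "TYPE(complex)" .
  define ws where "ws = gram_schmidt n (basis_completion v)"
  note bc = basis_completion[OF v]
  have ws: "set ws \<subseteq> carrier_vec n" "corthogonal ws" "length ws = n"
    using gram_schmidt_result[OF bc(2,4,5) ws_def] bc(6) by auto
  obtain vs where vs: "basis_completion v = v # vs"
    using bc(7) by (simp add: basis_completion_def Let_def)
  have hd: "hd ws = v" unfolding ws_def vs using v(1) by (rule gram_schmidt_hd)
  have n0: "n \<noteq> 0" using v by (auto simp: zero_vec_def)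
  have car: "ws ! j \<in> carrier_vec n" if "j < n" for j
    using ws(1,3) that by (metis nth_mem subsetD)
  define q where "q j = (\<Sum>i<n. (cmod (ws ! j $ i))\<^sup>2)" for j
  have q: "ws ! j \<bullet>c ws ! j = complex_of_real (q j)" if "j < n" for j
    using car[OF that] by (simp add: cscalar_prod_self q_def)
  have q0: "q j > 0" if "j < n" for j
  proof -
    have "q j \<noteq> 0" using corthogonalD[OF ws(2), of j j] that ws(3) q by auto
    moreover have "q j \<ge> 0" unfolding q_def by (intro sum_nonneg) auto
    ultimately show ?thesis by simp
  qed
  define W where "W = mat n n (\<lambda>(i,j). complex_of_real (1 / sqrt (q j)) * ws ! j $ i)"
  have W: "W \<in> carrier_mat n n" by (simp add: W_def)
  have "mat_adjoint W * W = 1\<^sub>m n"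
  proof (rule eq_matI)
    fix i j assume "i < dim_row (1\<^sub>m n :: complex mat)" "j < dim_col (1\<^sub>m n :: complex mat)"
    then have ij: "i < n" "j < n" by auto
    have "(mat_adjoint W * W) $$ (i,j) = (\<Sum>l<n. cnj (W $$ (l,i)) * W $$ (l,j))"
      using ij W by (simp add: scalar_prod_def atLeast0LessThan)
    also have "\<dots> = (\<Sum>l<n. complex_of_real (1 / sqrt (q i) * (1 / sqrt (q j))) * (ws ! j $ l * cnj (ws ! i $ l)))"
      using ij by (intro sum.cong) (auto simp: W_def)
    also have "\<dots> = complex_of_real (1 / sqrt (q i) * (1 / sqrt (q j))) * (ws ! j \<bullet>c ws ! i)"
      unfolding sum_distrib_left[symmetric] using carrier_vecD[OF car[OF ij(1)]]
      by (simp add: scalar_prod_def atLeast0LessThan)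
    also have "\<dots> = 1\<^sub>m n $$ (i,j)"
    proof (cases "i = j")
      case True
      have "complex_of_real (1 / sqrt (q i) * (1 / sqrt (q i))) * complex_of_real (q i) = 1"
        unfolding of_real_mult[symmetric] using q0[OF ij(1)] by simp
      then show ?thesis using True ij q by simp
    next
      case False
      then have "ws ! j \<bullet>c ws ! i = 0" using corthogonalD[OF ws(2), of j i] ij ws(3) by simp
      then show ?thesis using False ij by simp
    qed
    finally show "(mat_adjoint W * W) $$ (i,j) = 1\<^sub>m n $$ (i,j)" .
  qed (use W in auto)
  moreover have "col W 0 = complex_of_real (1 / sqrt (q 0)) \<cdot>\<^sub>v v"
  proof -
    have "ws ! 0 = v" using hd ws(3) n0 by (metis hd_conv_nth list.size(3))
    then show ?thesis using n0 v by (intro eq_vecI) (auto simp: W_def)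
  qed
  ultimately show thesis using W that by blast
qed

text \<open>Rectangular, because these matrices also provide the extremal example.\<close>

definition real_diag_mat :: "nat \<Rightarrow> nat \<Rightarrow> (nat \<Rightarrow> real) \<Rightarrow> complex mat" where
  "real_diag_mat m n d = mat m n (\<lambda>(i, j). if i = j then complex_of_real (d i) else 0)"

lemma real_diag_mat_carrier [simp]: "real_diag_mat m n d \<in> carrier_mat m n"
  by (simp add: real_diag_mat_def)

lemma real_diag_mat_dims [simp]:
  "dim_row (real_diag_mat m n d) = m" "dim_col (real_diag_mat m n d) = n"
  by (simp_all add: real_diag_mat_def)

lemma real_diag_mat_index [simp]:
  "i < m \<Longrightarrow> j < n \<Longrightarrow> real_diag_mat m n d $$ (i, j) = (if i = j then complex_of_real (d i) else 0)"
  by (simp add: real_diag_mat_def)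

lemma complex_mat_has_eigenvector:
  fixes H :: "complex mat"
  assumes H: "H \<in> carrier_mat (Suc k) (Suc k)"
  obtains e v where "v \<in> carrier_vec (Suc k)" "v \<noteq> 0\<^sub>v (Suc k)" "H *\<^sub>v v = e \<cdot>\<^sub>v v"
proof -
  have "degree (char_poly H) = Suc k" using degree_monic_char_poly[OF H] by simp
  then have "\<not> constant (poly (char_poly H))" by (simp add: constant_degree)
  then obtain e where "poly (char_poly H) e = 0"
    using fundamental_theorem_of_algebra by blast
  then have "eigenvalue H e" by (simp add: eigenvalue_root_char_poly[OF H])
  then show thesis using that H unfolding eigenvalue_def eigenvector_def by auto
qed

text \<open>The spectral theorem. A unitary change of basis that puts an eigenvector first makes the first column a
  multiple of the first unit vector; since the result is again Hermitian, so is the first row, and the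
  remaining block is handled by induction on the dimension.\<close>

lemma hermitian_diagonalization:
  fixes H :: "complex mat"
  assumes "H \<in> carrier_mat n n" "mat_adjoint H = H"
  obtains V d where "V \<in> carrier_mat n n" "mat_adjoint V * V = 1\<^sub>m n" "V * mat_adjoint V = 1\<^sub>m n"
    "H = V * real_diag_mat n n d * mat_adjoint V"
proof -
  have "\<exists>V d. V \<in> carrier_mat n n \<and> mat_adjoint V * V = 1\<^sub>m n \<and>
    H = V * real_diag_mat n n d * mat_adjoint V"
    using assms
  proof (induction n arbitrary: H)
    case 0
    then show ?case
      by (intro exI[of _ "1\<^sub>m 0"] exI[of _ "\<lambda>_. 0"] conjI) (auto intro!: eq_matI)
  next
    case (Suc k)
    let ?n = "Suc k"
    note H = Suc.prems
    obtain e v where v: "v \<in> carrier_vec ?n" "v \<noteq> 0\<^sub>v ?n" "H *\<^sub>v v = e \<cdot>\<^sub>v v"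
      using complex_mat_has_eigenvector[OF H(1)] .
    obtain W c where W: "W \<in> carrier_mat ?n ?n" "mat_adjoint W * W = 1\<^sub>m ?n" "col W 0 = c \<cdot>\<^sub>v v"
      using exists_unitary_with_first_col[OF v(1,2)] .
    have W': "mat_adjoint W \<in> carrier_mat ?n ?n" using W by simp
    have WW: "W * mat_adjoint W = 1\<^sub>m ?n"
      by (rule mat_mult_left_right_inverse[OF W' W(1,2)])
    define K where "K = mat_adjoint W * (H * W)"
    have K: "K \<in> carrier_mat ?n ?n" using W H by (auto simp: K_def)
    have K_adj: "mat_adjoint K = K"
      using W H by (simp add: K_def mat_adjoint_mult[of _ ?n ?n _ ?n] assoc_mult_mat[of _ ?n ?n _ ?n _ ?n])
    have K_col: "col K 0 = e \<cdot>\<^sub>v unit_vec ?n 0"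
    proof -
      have "col K 0 = mat_adjoint W *\<^sub>v (H *\<^sub>v col W 0)"
        unfolding K_def col_mult2[OF W' mult_carrier_mat[OF H(1) W(1)] zero_less_Suc]
          col_mult2[OF H(1) W(1) zero_less_Suc] ..
      also have "H *\<^sub>v col W 0 = e \<cdot>\<^sub>v col W 0"
        unfolding W(3) using H v by (simp add: mult_mat_vec smult_smult_assoc mult.commute)
      also have "mat_adjoint W *\<^sub>v (e \<cdot>\<^sub>v col W 0) = e \<cdot>\<^sub>v col (mat_adjoint W * W) 0"
        using mult_mat_vec[OF W', of "col W 0" e] carrier_vecI[of "col W 0" ?n] W(1)
        by (simp add: col_mult2[OF W' W(1)])
      finally show ?thesis unfolding W(2) by simp
    qed
    have K0: "K $$ (i, 0) = (if i = 0 then e else 0)" if "i < ?n" for i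
      using arg_cong[OF K_col, of "\<lambda>x. x $ i"] that K by simp
    have K_sym: "K $$ (j, i) = cnj (K $$ (i, j))" if "i < ?n" "j < ?n" for i j
      using arg_cong[OF K_adj, of "\<lambda>X. X $$ (j, i)"] that K by simp
    have K0': "K $$ (0, i) = (if i = 0 then e else 0)" if "i < ?n" for i
      using K_sym[of i 0] K0[OF that] K0[of 0] that by (cases "i = 0") auto
    have e: "complex_of_real (Re e) = e"
      using K_sym[of 0 0] K0[of 0] by (simp add: complex_eq_iff)
    define K3 where "K3 = mat k k (\<lambda>(i,j). K $$ (Suc i, Suc j))"
    have K3: "K3 \<in> carrier_mat k k" by (simp add: K3_def)
    have K3_adj: "mat_adjoint K3 = K3"
      by (rule eq_matI) (auto simp: K3_def intro: K_sym[symmetric])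
    obtain P d where P: "P \<in> carrier_mat k k" "mat_adjoint P * P = 1\<^sub>m k"
      "K3 = P * real_diag_mat k k d * mat_adjoint P"
      using Suc.IH[OF K3 K3_adj] by blast
    define F where "F = four_block_mat (1\<^sub>m 1) (0\<^sub>m 1 k) (0\<^sub>m k 1) P"
    have F: "F \<in> carrier_mat ?n ?n" unfolding F_def using four_block_carrier_mat[OF one_carrier_mat[of 1] P(1)] by simp
    have F_adj: "mat_adjoint F = four_block_mat (1\<^sub>m 1) (0\<^sub>m 1 k) (0\<^sub>m k 1) (mat_adjoint P)"
      using P(1) by (intro eq_matI) (auto simp: F_def)
    define d' where "d' i = (case i of 0 \<Rightarrow> Re e | Suc i \<Rightarrow> d i)" for i
    let ?D = "real_diag_mat ?n ?n d'"
    have D: "?D = four_block_mat (real_diag_mat 1 1 (\<lambda>_. Re e)) (0\<^sub>m 1 k) (0\<^sub>m k 1) (real_diag_mat k k d)"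
      by (rule eq_matI) (auto simp: d'_def split: nat.splits)
    have FF: "mat_adjoint F * F = 1\<^sub>m ?n"
    proof -
      have "mat_adjoint F * F = four_block_mat (1\<^sub>m 1) (0\<^sub>m 1 k) (0\<^sub>m k 1) (1\<^sub>m k)"
        unfolding F_adj unfolding F_def using P
        by (subst mult_four_block_mat[of _ 1 1 _ k _ k _ _ 1 _ k]) auto
      then show ?thesis by (metis four_block_one_mat plus_1_eq_Suc)
    qed
    have PDP: "P * real_diag_mat k k d * mat_adjoint P \<in> carrier_mat k k"
      using K3 unfolding P(3) .
    have FK: "F * ?D * mat_adjoint F = K"
    proof -
      have "F * ?D * mat_adjoint F = four_block_mat (real_diag_mat 1 1 (\<lambda>_. Re e)) (0\<^sub>m 1 k) (0\<^sub>m k 1) K3"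
        unfolding F_adj D unfolding F_def P(3) using P(1) PDP
        by (subst mult_four_block_mat[of _ 1 1 _ k _ k _ _ 1 _ k], simp_all)
          (subst mult_four_block_mat[of _ 1 1 _ k _ k _ _ 1 _ k], simp_all)
      also have "\<dots> = K"
      proof (rule eq_matI)
        fix i j assume ij: "i < dim_row K" "j < dim_col K"
        then have "i < ?n" "j < ?n" using K by auto
        then show "four_block_mat (real_diag_mat 1 1 (\<lambda>_. Re e)) (0\<^sub>m 1 k) (0\<^sub>m k 1) K3 $$ (i, j) = K $$ (i, j)"
          using K0[of i] K0'[of j] e by (cases i; cases j) (auto simp: K3_def)
      qed (use K in \<open>auto simp: K3_def\<close>)
      finally show ?thesis .
    qed
    define V where "V = W * F"
    have V: "V \<in> carrier_mat ?n ?n" using W F by (simp add: V_def)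
    have V_adj: "mat_adjoint V = mat_adjoint F * mat_adjoint W"
      unfolding V_def by (rule mat_adjoint_mult[OF W(1) F])
    have F': "mat_adjoint F \<in> carrier_mat ?n ?n" using F by simp
    have Dc: "?D \<in> carrier_mat ?n ?n" by simp
    have WF: "mat_adjoint W * (W * F) = F"
      using assoc_mult_mat[OF W' W(1) F] W(2) F by simp
    have VV: "mat_adjoint V * V = 1\<^sub>m ?n"
      unfolding V_adj unfolding V_def
      using assoc_mult_mat[OF F' W' mult_carrier_mat[OF W(1) F]] WF FF by simp
    have "V * ?D * mat_adjoint V = W * (F * ?D * mat_adjoint F) * mat_adjoint W"
    proof -
      have G: "F * ?D \<in> carrier_mat ?n ?n" using F Dc by (rule mult_carrier_mat)
      show ?thesis
        unfolding V_adj unfolding V_def assoc_mult_mat[OF W(1) F Dc]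
          assoc_mult_mat[OF mult_carrier_mat[OF W(1) G] F' W', symmetric]
          assoc_mult_mat[OF W(1) G F'] ..
    qed
    also have "\<dots> = H * W * mat_adjoint W"
      unfolding FK K_def assoc_mult_mat[OF W(1) W' mult_carrier_mat[OF H(1) W(1)], symmetric] WW
      using left_mult_one_mat[OF mult_carrier_mat[OF H(1) W(1)]] by simp
    also have "\<dots> = H"
      unfolding assoc_mult_mat[OF H(1) W(1) W'] WW using H(1) by simp
    finally show ?case using V VV by metis
  qed
  then obtain V d where V: "V \<in> carrier_mat n n" "mat_adjoint V * V = 1\<^sub>m n"
    "H = V * real_diag_mat n n d * mat_adjoint V" by blast
  moreover have "V * mat_adjoint V = 1\<^sub>m n"
    by (rule mat_mult_left_right_inverse[OF _ V(1,2)]) (use V in simp)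
  ultimately show thesis using that by blast
qed

section \<open>Simultaneous singular expansions of a matrix and its polar factor\<close>

text \<open>The expansion needed for polarization.\<close>

lemma cscalar_prod_add_smult:
  fixes p q :: "complex vec"
  assumes "p \<in> carrier_vec k" "q \<in> carrier_vec k"
  shows "(p + c \<cdot>\<^sub>v q) \<bullet>c (p + c \<cdot>\<^sub>v q) =
    p \<bullet>c p + c * cnj c * (q \<bullet>c q) + cnj c * (p \<bullet>c q) + c * cnj (p \<bullet>c q)"
  using assms
  by (simp add: scalar_prod_def sum_distrib_left algebra_simps sum.distrib)

text \<open>The range of \<open>Q\<^sup>*\<close> is orthogonal to the kernel of \<open>Q\<close>, so \<open>Q\<close>
  preserves norms on it, and hence inner products by polarization with the factors 1 and \<open>\<i>\<close>.\<close>

lemma subunitary_preserves_cscalar_prod: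
  fixes Q :: "complex mat"
  assumes Q: "Q \<in> carrier_mat m n" "subunitary Q"
    and x: "x \<in> vec_space.col_space n (mat_adjoint Q)" and y: "y \<in> vec_space.col_space n (mat_adjoint Q)"
  shows "(Q *\<^sub>v x) \<bullet>c (Q *\<^sub>v y) = x \<bullet>c y"
proof -
  have Q': "mat_adjoint Q \<in> carrier_mat n m" using Q by simp
  obtain x' y' where x': "x' \<in> carrier_vec m" "x = mat_adjoint Q *\<^sub>v x'"
    and y': "y' \<in> carrier_vec m" "y = mat_adjoint Q *\<^sub>v y'"
    using x y Q Q' unfolding vec_space.col_space_eq[OF Q'] by auto
  have xc: "x \<in> carrier_vec n" "y \<in> carrier_vec n" using x' y' Q' by auto
  have norm: "(Q *\<^sub>v (x + c \<cdot>\<^sub>v y)) \<bullet>c (Q *\<^sub>v (x + c \<cdot>\<^sub>v y)) = (x + c \<cdot>\<^sub>v y) \<bullet>c (x + c \<cdot>\<^sub>v y)" for c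
  proof -
    have xy: "x + c \<cdot>\<^sub>v y = mat_adjoint Q *\<^sub>v (x' + c \<cdot>\<^sub>v y')"
      using x' y' Q' by (simp add: mult_add_distrib_mat_vec[of _ n m] mult_mat_vec[of _ n m])
    have "(x + c \<cdot>\<^sub>v y) \<bullet>c z = 0" if z: "z \<in> mat_kernel Q" for z
    proof -
      have "z \<in> carrier_vec n" "Q *\<^sub>v z = 0\<^sub>v m" using mat_kernelD[OF Q(1) z] by auto
      then show ?thesis
        unfolding xy using x' y' cscalar_prod_mult_mat_vec[OF Q', of "x' + c \<cdot>\<^sub>v y'" z] by simp
    qed
    then show ?thesis using Q xc unfolding subunitary_def by auto
  qed
  have Qxy: "Q *\<^sub>v (x + c \<cdot>\<^sub>v y) = Q *\<^sub>v x + c \<cdot>\<^sub>v (Q *\<^sub>v y)" for c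
    using xc Q by (simp add: mult_add_distrib_mat_vec[of _ m n] mult_mat_vec[of _ m n])
  have c: "Q *\<^sub>v x \<in> carrier_vec m" "Q *\<^sub>v y \<in> carrier_vec m" using xc Q by auto
  note eq = norm[unfolded Qxy cscalar_prod_add_smult[OF c] cscalar_prod_add_smult[OF xc]]
  have "(Q *\<^sub>v x) \<bullet>c (Q *\<^sub>v x) = x \<bullet>c x" using eq[of 0] by simp
  moreover have "(Q *\<^sub>v y) \<bullet>c (Q *\<^sub>v y) = y \<bullet>c y"
    using eq[of 1] eq[of "-1"] calculation by (simp add: complex_eq_iff)
  ultimately show ?thesis
    using eq[of 1] eq[of \<i>] by (simp add: complex_eq_iff)
qed

lemma proots_prod_linear_factors:
  "proots (\<Prod>a\<leftarrow>xs. [:- a, 1:]) = mset (xs :: complex list)"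
proof (induction xs)
  case (Cons a xs)
  have "(\<Prod>a\<leftarrow>xs. [:- a, 1:]) \<noteq> (0 :: complex poly)"
    by (auto simp: prod_list_zero_iff)
  with Cons show ?case by (simp add: proots_mult del: mult_pCons_left)
qed simp

lemma proots_char_poly_unitary_conj_real_diag:
  assumes V: "V \<in> carrier_mat n n" "mat_adjoint V * V = 1\<^sub>m n" "V * mat_adjoint V = 1\<^sub>m n"
  shows "proots (char_poly (V * real_diag_mat n n d * mat_adjoint V)) =
    image_mset (\<lambda>j. complex_of_real (d j)) (mset_set {..<n})"
proof -
  let ?D = "real_diag_mat n n d"
  have "similar_mat (V * ?D * mat_adjoint V) ?D"
    unfolding similar_mat_def
    by (intro exI, rule similar_mat_witI[OF V(3,2) refl, of ?D]) (use V in auto)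
  then have "char_poly (V * ?D * mat_adjoint V) = char_poly ?D" by (rule char_poly_similar)
  also have "\<dots> = (\<Prod>a\<leftarrow>diag_mat ?D. [:- a, 1:])"
    by (rule char_poly_upper_triangular[of _ n]) auto
  finally have "proots (char_poly (V * ?D * mat_adjoint V)) = mset (diag_mat ?D)"
    by (simp add: proots_prod_linear_factors)
  also have "diag_mat ?D = map (\<lambda>j. complex_of_real (d j)) [0..<n]"
    by (simp add: diag_mat_def)
  finally show ?thesis by (simp add: atLeast0LessThan mset_upt)
qed

text \<open>Two enumerations of the same multiset differ by a bijection of the index sets. This turns the
  equality of multisets of singular values into a labelling of eigenvectors.\<close>

lemma bij_betw_of_image_mset_eq:
  assumes "finite S" "finite T" "image_mset f (mset_set S) = image_mset g (mset_set T)"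
  obtains h where "bij_betw h S T" "\<And>x. x \<in> S \<Longrightarrow> f x = g (h x)"
proof -
  have "card S = card T" using arg_cong[OF assms(3), of size] by simp
  then obtain e where e: "bij_betw e S T" using assms(1,2) finite_same_card_bij by blast
  have "mset_set T = image_mset e (mset_set S)"
    using e by (simp add: bij_betw_def image_mset_mset_set)
  then have "image_mset f (mset_set S) = image_mset (g \<circ> e) (mset_set S)"
    using assms(3) by (simp add: multiset.map_comp)
  then obtain p where p: "p permutes S" "\<forall>x\<in>S. f x = (g \<circ> e) (p x)"
    using image_mset_eq_implies_permutes[OF assms(1)] by metis
  show thesis
  proof
    show "bij_betw (e \<circ> p) S T" using permutes_imp_bij[OF p(1)] e by (rule bij_betw_trans)
  qed (use p in auto)
qed

lemma mat_vec_unit_eq_col: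
  fixes A :: "complex mat"
  assumes "A \<in> carrier_mat m n" "j < n"
  shows "A *\<^sub>v unit_vec n j = col A j"
  using assms
  by (intro eq_vecI) (auto simp: scalar_prod_def unit_vec_def if_distrib sum.delta cong: if_cong)

text \<open>Vectors are functions of which only the values below the dimension count; sums over singular
  vectors then are ordinary finite sums of complex numbers.\<close>

definition orthonormal_on :: "nat \<Rightarrow> 'i set \<Rightarrow> ('i \<Rightarrow> nat \<Rightarrow> complex) \<Rightarrow> bool" where
  "orthonormal_on m I f \<longleftrightarrow> (\<forall>i\<in>I. \<forall>j\<in>I. (\<Sum>a<m. f i a * cnj (f j a)) = of_bool (i = j))"

text \<open>For positive \<open>\<alpha>\<close> this is a singular value decomposition of \<open>X\<close>. With all
  \<open>\<alpha> i = 1\<close> it is the corresponding form of a partial isometry.\<close>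

definition singular_expansion ::
    "nat \<Rightarrow> nat \<Rightarrow> 'i set \<Rightarrow> ('i \<Rightarrow> real) \<Rightarrow> ('i \<Rightarrow> nat \<Rightarrow> complex) \<Rightarrow> ('i \<Rightarrow> nat \<Rightarrow> complex) \<Rightarrow>
     complex mat \<Rightarrow> bool" where
  "singular_expansion m n I \<alpha> u v X \<longleftrightarrow>
     orthonormal_on m I u \<and> orthonormal_on n I v \<and>
     (\<forall>a<m. \<forall>b<n. X $$ (a, b) = (\<Sum>i\<in>I. of_real (\<alpha> i) * u i a * cnj (v i b)))"

text \<open>Diagonalize \<open>H\<close>. The eigenvectors with nonzero eigenvalue span the range of
  \<open>H\<close>, which is the range of \<open>Q\<^sup>*\<close>; they serve as the right singular vectors, and their
  images under \<open>Q\<close> are orthonormal and serve as the left ones. The eigenvectors for the eigenvalue 0 are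
  orthogonal to the range of \<open>Q\<^sup>*\<close>, so \<open>Q\<close> kills them. Since
  \<open>A\<^sup>* A\<close> is unitarily similar to the diagonal matrix of the squared eigenvalues of \<open>H\<close>,
  the nonzero eigenvalues of \<open>H\<close> are the given singular values.\<close>

lemma polar_decomposition_singular_expansion:
  assumes A: "A \<in> carrier_mat m n" and gpd: "generalized_polar_decomposition A Q H"
    and sv: "has_nonzero_singular_values A r \<sigma>"
  obtains u v where "singular_expansion m n {1..r} \<sigma> u v A" "singular_expansion m n {1..r} (\<lambda>_. 1) u v Q"
proof -
  have Q: "Q \<in> carrier_mat m n" "subunitary Q" and H: "H \<in> carrier_mat n n" "positive_semidefinite H"
    and AQH: "A = Q * H" and ran: "vec_space.col_space n (mat_adjoint Q) = vec_space.col_space n H"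
    using gpd A unfolding generalized_polar_decomposition_def Let_def rank_mats_def by auto
  have H_adj: "mat_adjoint H = H" using H unfolding positive_semidefinite_def by auto
  have Q': "mat_adjoint Q \<in> carrier_mat n m" using Q by simp
  obtain V d where V: "V \<in> carrier_mat n n" "mat_adjoint V * V = 1\<^sub>m n" "V * mat_adjoint V = 1\<^sub>m n"
    and HV: "H = V * real_diag_mat n n d * mat_adjoint V"
    using hermitian_diagonalization[OF H(1) H_adj] .
  let ?D = "real_diag_mat n n d"
  have V': "mat_adjoint V \<in> carrier_mat n n" using V by simp
  have D: "?D \<in> carrier_mat n n" by simp
  have colV: "col V j \<in> carrier_vec n" for j using V(1) by (intro carrier_vecI) simp
  have V_orth: "col V i \<bullet>c col V j = of_bool (i = j)" if "i < n" "j < n" for i j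
    using arg_cong[OF V(2), of "\<lambda>X. X $$ (j, i)"] that V(1)
    by (auto simp: scalar_prod_def mult.commute split: if_splits)
  have Hcol: "H *\<^sub>v col V j = complex_of_real (d j) \<cdot>\<^sub>v col V j" if j: "j < n" for j
  proof -
    have "H * V = V * ?D * (mat_adjoint V * V)"
      unfolding HV by (rule assoc_mult_mat[OF mult_carrier_mat[OF V(1) D] V' V(1)])
    then have "H * V = V * ?D" unfolding V(2) using V(1) by simp
    then have "H *\<^sub>v col V j = col (V * ?D) j" using j H(1) V(1) by (metis col_mult2)
    also have "\<dots> = V *\<^sub>v col ?D j" using j V(1) by (simp add: col_mult2[of _ n n _ n])
    also have "col ?D j = complex_of_real (d j) \<cdot>\<^sub>v unit_vec n j" using j by (intro eq_vecI) auto
    also have "V *\<^sub>v (complex_of_real (d j) \<cdot>\<^sub>v unit_vec n j) = complex_of_real (d j) \<cdot>\<^sub>v col V j"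
      using j V(1) by (simp add: mult_mat_vec[of _ n n] mat_vec_unit_eq_col)
    finally show ?thesis .
  qed
  have d0: "0 \<le> d j" if j: "j < n" for j
  proof -
    have "0 \<le> Re ((H *\<^sub>v col V j) \<bullet>c col V j)"
      using H colV unfolding positive_semidefinite_def by auto
    also have "\<dots> = d j" unfolding Hcol[OF j] using colV V_orth[OF j j] by simp
    finally show ?thesis .
  qed
  define B where "B = Q * V"
  have B: "B \<in> carrier_mat m n" using Q V by (simp add: B_def)
  have colB: "col B j = Q *\<^sub>v col V j" if "j < n" for j
    unfolding B_def using that Q(1) V(1) by (rule col_mult2[rotated 2])
  have B0: "col B j = 0\<^sub>v m" if j: "j < n" "d j = 0" for j
  proof -
    let ?y = "Q *\<^sub>v col V j"
    have y: "?y \<in> carrier_vec m" using Q(1) colV by (rule mult_mat_vec_carrier)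
    have "mat_adjoint Q *\<^sub>v ?y \<in> vec_space.col_space n (mat_adjoint Q)"
      unfolding vec_space.col_space_eq[OF Q'] using Q y mult_mat_vec_carrier[OF Q' y] by auto
    then obtain x where x: "x \<in> carrier_vec n" "mat_adjoint Q *\<^sub>v ?y = H *\<^sub>v x"
      unfolding ran vec_space.col_space_eq[OF H(1)] using H(1) by auto
    have "?y \<bullet>c ?y = col V j \<bullet>c (H *\<^sub>v x)"
      using cscalar_prod_mult_mat_vec[OF Q(1) colV y] x by simp
    also have "\<dots> = (H *\<^sub>v col V j) \<bullet>c x"
      using cscalar_prod_mult_mat_vec[OF H(1) colV x(1)] H_adj by simp
    also have "\<dots> = 0" unfolding Hcol[OF j(1)] using j x V(1) by (simp add: scalar_prod_def)
    finally have "?y = 0\<^sub>v m" using conjugate_square_eq_0_vec[OF y] by simp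
    then show ?thesis using colB[OF j(1)] by simp
  qed
  have ranV: "col V j \<in> vec_space.col_space n (mat_adjoint Q)" if j: "j < n" "d j \<noteq> 0" for j
  proof -
    have "H *\<^sub>v (complex_of_real (1 / d j) \<cdot>\<^sub>v col V j) = complex_of_real (1 / d j) \<cdot>\<^sub>v (H *\<^sub>v col V j)"
      using H(1) colV by (rule mult_mat_vec)
    also have "\<dots> = col V j" unfolding Hcol[OF j(1)] using j(2) by (simp add: smult_smult_assoc)
    finally show ?thesis
      unfolding ran vec_space.col_space_eq[OF H(1)] using H(1) colV
      by (auto intro!: bexI[of _ "complex_of_real (1 / d j) \<cdot>\<^sub>v col V j"])
  qed
  have B_orth: "col B i \<bullet>c col B j = of_bool (i = j)" if "i < n" "j < n" "d i \<noteq> 0" "d j \<noteq> 0" for i j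
    using subunitary_preserves_cscalar_prod[OF Q ranV ranV] that V_orth by (simp add: colB)
  have AB: "A = B * ?D * mat_adjoint V"
    unfolding AQH HV B_def using Q V V' D by (simp add: assoc_mult_mat[of _ m n _ n _ n] assoc_mult_mat[of _ n n _ n _ n])
  have QB: "Q = B * mat_adjoint V"
    unfolding B_def using Q V V' by (simp add: assoc_mult_mat[of _ m n _ n _ n])
  have BD: "B * ?D = mat m n (\<lambda>(a, j). B $$ (a, j) * complex_of_real (d j))"
    using B by (intro eq_matI) (auto simp: scalar_prod_def sum.delta if_distrib cong: if_cong)
  \<comment> \<open>The columns of B with d j = 0 vanish and the others are orthonormal, so only the squares of d survive.\<close>
  have DBBD: "mat_adjoint (B * ?D) * (B * ?D) = real_diag_mat n n (\<lambda>j. (d j)\<^sup>2)"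
  proof (rule eq_matI, goal_cases)
    case (1 i j)
    then have ij: "i < n" "j < n" by auto
    have "(mat_adjoint (B * ?D) * (B * ?D)) $$ (i, j)
      = (\<Sum>a<m. cnj (B $$ (a, i)) * complex_of_real (d i) * (B $$ (a, j) * complex_of_real (d j)))"
      unfolding BD using ij by (simp add: scalar_prod_def atLeast0LessThan)
    also have "\<dots> = complex_of_real (d i * d j) * (col B j \<bullet>c col B i)"
      using ij B by (simp add: scalar_prod_def atLeast0LessThan sum_distrib_left mult_ac)
    also have "\<dots> = real_diag_mat n n (\<lambda>j. (d j)\<^sup>2) $$ (i, j)"
      using ij B_orth[of j i] by (cases "d i = 0 \<or> d j = 0") (auto simp: power2_eq_square)
    finally show ?case .
  qed auto
  have BDc: "B * ?D \<in> carrier_mat m n" using B by simp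
  have "mat_adjoint A * A = V * real_diag_mat n n (\<lambda>j. (d j)\<^sup>2) * mat_adjoint V"
    unfolding AB mat_adjoint_mult[OF BDc V'] mat_adjoint_adjoint DBBD[symmetric]
      assoc_mult_mat[OF mult_carrier_mat[OF V(1) mat_adjoint_carrier[OF BDc]] BDc V', symmetric]
      assoc_mult_mat[OF V(1) mat_adjoint_carrier[OF BDc] BDc] ..
  then have "nonzero_singular_values A = filter_mset (\<lambda>x. x \<noteq> 0) (image_mset (\<lambda>j. \<bar>d j\<bar>) (mset_set {..<n}))"
    unfolding nonzero_singular_values_def
    by (simp add: proots_char_poly_unitary_conj_real_diag[OF V] multiset.map_comp o_def)
  also have "image_mset (\<lambda>j. \<bar>d j\<bar>) (mset_set {..<n}) = image_mset d (mset_set {..<n})"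
    using d0 by (intro image_mset_cong) auto
  also have "filter_mset (\<lambda>x. x \<noteq> 0) \<dots> = image_mset d (mset_set {j \<in> {..<n}. d j \<noteq> 0})"
    by (simp add: filter_mset_image_mset)
  finally have "image_mset \<sigma> (mset_set {1..r}) = image_mset d (mset_set {j \<in> {..<n}. d j \<noteq> 0})"
    using sv unfolding has_nonzero_singular_values_def by simp
  then obtain h where h: "bij_betw h {1..r} {j \<in> {..<n}. d j \<noteq> 0}" "\<And>i. i \<in> {1..r} \<Longrightarrow> \<sigma> i = d (h i)"
    by (rule bij_betw_of_image_mset_eq[rotated 2]) auto
  have hn: "h i < n" "d (h i) \<noteq> 0" if "i \<in> {1..r}" for i
    using bij_betwE[OF h(1)] that by auto
  have h_inj: "h i = h j \<longleftrightarrow> i = j" if "i \<in> {1..r}" "j \<in> {1..r}" for i j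
    using h(1) that by (auto simp: bij_betw_def dest: inj_onD)
  have reindex: "(\<Sum>j<n. g j) = (\<Sum>i=1..r. g (h i))"
    if "\<And>j. j < n \<Longrightarrow> d j = 0 \<Longrightarrow> g j = 0" for g :: "nat \<Rightarrow> complex"
  proof -
    have "(\<Sum>j<n. g j) = (\<Sum>j\<in>{j \<in> {..<n}. d j \<noteq> 0}. g j)"
      by (rule sum.mono_neutral_right) (use that in auto)
    also have "\<dots> = (\<Sum>i=1..r. g (h i))" by (rule sum.reindex_bij_betw[OF h(1), symmetric])
    finally show ?thesis .
  qed
  have B0': "B $$ (a, j) = 0" if "a < m" "j < n" "d j = 0" for a j
    using arg_cong[OF B0[OF that(2,3)], of "\<lambda>x. x $ a"] that B by simp
  let ?u = "\<lambda>i a. B $$ (a, h i)" and ?v = "\<lambda>i b. V $$ (b, h i)"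
  have "(\<Sum>a<m. ?u i a * cnj (?u j a)) = of_bool (i = j)"
    and "(\<Sum>a<n. ?v i a * cnj (?v j a)) = of_bool (i = j)" if ij: "i \<in> {1..r}" "j \<in> {1..r}" for i j
    using B_orth[of "h i" "h j"] V_orth[of "h i" "h j"] hn ij B V(1)
    by (simp_all add: scalar_prod_def atLeast0LessThan h_inj)
  then have orth: "orthonormal_on m {1..r} ?u" "orthonormal_on n {1..r} ?v"
    unfolding orthonormal_on_def by blast+
  have A_entry: "A $$ (a, b) = (\<Sum>i=1..r. of_real (\<sigma> i) * ?u i a * cnj (?v i b))" if ab: "a < m" "b < n" for a b
  proof -
    have "A $$ (a, b) = (\<Sum>j<n. B $$ (a, j) * complex_of_real (d j) * cnj (V $$ (b, j)))"
      unfolding AB BD using ab V(1) by (simp add: scalar_prod_def atLeast0LessThan)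
    also have "\<dots> = (\<Sum>i=1..r. B $$ (a, h i) * complex_of_real (d (h i)) * cnj (V $$ (b, h i)))"
      by (rule reindex) simp
    finally show ?thesis using h(2) by (simp add: mult_ac)
  qed
  have Q_entry: "Q $$ (a, b) = (\<Sum>i=1..r. ?u i a * cnj (?v i b))" if ab: "a < m" "b < n" for a b
  proof -
    have "Q $$ (a, b) = (\<Sum>j<n. B $$ (a, j) * cnj (V $$ (b, j)))"
      using ab V(1) B by (subst QB) (simp add: scalar_prod_def atLeast0LessThan)
    also have "\<dots> = (\<Sum>i=1..r. ?u i a * cnj (?v i b))"
      by (rule reindex) (use B0' ab in auto)
    finally show ?thesis .
  qed
  show thesis
    by (rule that[of ?u ?v]) (use orth A_entry Q_entry in \<open>simp_all add: singular_expansion_def\<close>)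
qed

section \<open>The perturbation bound\<close>

lemma orthonormal_onD:
  "orthonormal_on m I f \<Longrightarrow> i \<in> I \<Longrightarrow> j \<in> I \<Longrightarrow> (\<Sum>a<m. f i a * cnj (f j a)) = of_bool (i = j)"
  by (simp add: orthonormal_on_def)

lemma singular_expansionD:
  assumes "singular_expansion m n I \<alpha> u v X"
  shows "orthonormal_on m I u" "orthonormal_on n I v"
    "a < m \<Longrightarrow> b < n \<Longrightarrow> X $$ (a, b) = (\<Sum>i\<in>I. of_real (\<alpha> i) * u i a * cnj (v i b))"
  using assms by (simp_all add: singular_expansion_def)

text \<open>With \<open>z\<close> the orthogonal projection of \<open>x\<close> on the span of the family, the
  difference of the two sides is \<open>\<parallel>x - z\<parallel>\<^sup>2\<close>.\<close>

lemma bessel_inequality: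
  fixes f :: "'j \<Rightarrow> nat \<Rightarrow> complex"
  assumes J: "finite J" and orth: "orthonormal_on m J f"
  shows "(\<Sum>j\<in>J. (cmod (\<Sum>a<m. x a * cnj (f j a)))\<^sup>2) \<le> (\<Sum>a<m. (cmod (x a))\<^sup>2)"
proof -
  define c where "c j = (\<Sum>a<m. x a * cnj (f j a))" for j
  define z where "z a = (\<Sum>j\<in>J. c j * f j a)" for a
  define N where "N = (\<Sum>j\<in>J. c j * cnj (c j))"
  have xz: "(\<Sum>a<m. x a * cnj (z a)) = N"
  proof -
    have "(\<Sum>a<m. x a * cnj (z a)) = (\<Sum>a<m. \<Sum>j\<in>J. cnj (c j) * (x a * cnj (f j a)))"
      by (simp add: z_def sum_distrib_left mult_ac)
    also have "\<dots> = (\<Sum>j\<in>J. cnj (c j) * c j)"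
      by (subst sum.swap) (simp add: c_def sum_distrib_left)
    finally show ?thesis by (simp add: N_def mult.commute)
  qed
  have zz: "(\<Sum>a<m. z a * cnj (z a)) = N"
  proof -
    have "(\<Sum>a<m. z a * cnj (z a)) = (\<Sum>a<m. \<Sum>i\<in>J. \<Sum>j\<in>J. c i * cnj (c j) * (f i a * cnj (f j a)))"
      by (simp add: z_def sum_product mult_ac)
    also have "\<dots> = (\<Sum>i\<in>J. \<Sum>a<m. \<Sum>j\<in>J. c i * cnj (c j) * (f i a * cnj (f j a)))"
      by (rule sum.swap)
    also have "\<dots> = (\<Sum>i\<in>J. \<Sum>j\<in>J. c i * cnj (c j) * (\<Sum>a<m. f i a * cnj (f j a)))"
      by (rule sum.cong[OF refl], subst sum.swap) (simp add: sum_distrib_left)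
    also have "\<dots> = (\<Sum>i\<in>J. \<Sum>j\<in>J. if j = i then c i * cnj (c j) else 0)"
      by (intro sum.cong refl) (auto simp: orthonormal_onD[OF orth])
    also have "\<dots> = N" using J by (simp add: N_def sum.delta)
    finally show ?thesis .
  qed
  have cN: "cnj N = N" by (simp add: N_def mult.commute)
  have zx: "(\<Sum>a<m. z a * cnj (x a)) = N"
    using arg_cong[OF xz, of cnj] by (simp add: cN mult.commute)
  have "complex_of_real (\<Sum>a<m. (cmod (x a - z a))\<^sup>2) = (\<Sum>a<m. (x a - z a) * cnj (x a - z a))"
    by (simp add: complex_norm_square del: of_real_power)
  also have "\<dots> = (\<Sum>a<m. x a * cnj (x a)) - (\<Sum>a<m. x a * cnj (z a)) - (\<Sum>a<m. z a * cnj (x a)) + (\<Sum>a<m. z a * cnj (z a))"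
    by (simp add: algebra_simps sum.distrib sum_subtractf)
  also have "\<dots> = (\<Sum>a<m. x a * cnj (x a)) - N" by (simp add: xz zx zz)
  also have "\<dots> = complex_of_real ((\<Sum>a<m. (cmod (x a))\<^sup>2) - (\<Sum>j\<in>J. (cmod (c j))\<^sup>2))"
    by (simp add: complex_norm_square N_def del: of_real_power)
  finally have "(\<Sum>a<m. (cmod (x a))\<^sup>2) - (\<Sum>j\<in>J. (cmod (c j))\<^sup>2) = (\<Sum>a<m. (cmod (x a - z a))\<^sup>2)"
    by (simp only: of_real_eq_iff)
  moreover have "\<dots> \<ge> 0" by (intro sum_nonneg) auto
  ultimately show ?thesis unfolding c_def by linarith
qed

lemma frobenius_inner_rank_one_sums:
  fixes u v :: "'i \<Rightarrow> nat \<Rightarrow> complex" and u' v' :: "'j \<Rightarrow> nat \<Rightarrow> complex"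
  assumes X: "\<And>a b. a < m \<Longrightarrow> b < n \<Longrightarrow> X a b = (\<Sum>i\<in>I. of_real (\<alpha> i) * u i a * cnj (v i b))"
    and Y: "\<And>a b. a < m \<Longrightarrow> b < n \<Longrightarrow> Y a b = (\<Sum>j\<in>J. of_real (\<beta> j) * u' j a * cnj (v' j b))"
  shows "(\<Sum>a<m. \<Sum>b<n. X a b * cnj (Y a b)) =
    (\<Sum>i\<in>I. \<Sum>j\<in>J. of_real (\<alpha> i * \<beta> j) *
      ((\<Sum>a<m. u i a * cnj (u' j a)) * cnj (\<Sum>b<n. v i b * cnj (v' j b))))"
proof -
  let ?g = "\<lambda>i j a b. of_real (\<alpha> i * \<beta> j) * (u i a * cnj (u' j a)) * cnj (v i b * cnj (v' j b))"
  have "(\<Sum>a<m. \<Sum>b<n. X a b * cnj (Y a b)) = (\<Sum>a<m. \<Sum>b<n. \<Sum>i\<in>I. \<Sum>j\<in>J. ?g i j a b)"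
    by (simp add: X Y sum_product mult_ac)
  also have "\<dots> = (\<Sum>a<m. \<Sum>i\<in>I. \<Sum>b<n. \<Sum>j\<in>J. ?g i j a b)"
    by (intro sum.cong refl sum.swap)
  also have "\<dots> = (\<Sum>i\<in>I. \<Sum>a<m. \<Sum>b<n. \<Sum>j\<in>J. ?g i j a b)"
    by (rule sum.swap)
  also have "\<dots> = (\<Sum>i\<in>I. \<Sum>a<m. \<Sum>j\<in>J. \<Sum>b<n. ?g i j a b)"
    by (intro sum.cong refl sum.swap)
  also have "\<dots> = (\<Sum>i\<in>I. \<Sum>j\<in>J. \<Sum>a<m. \<Sum>b<n. ?g i j a b)"
    by (intro sum.cong refl sum.swap)
  also have "\<dots> = (\<Sum>i\<in>I. \<Sum>j\<in>J. of_real (\<alpha> i * \<beta> j) *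
      ((\<Sum>a<m. u i a * cnj (u' j a)) * cnj (\<Sum>b<n. v i b * cnj (v' j b))))"
    by (intro sum.cong refl) (simp only: cnj_sum sum_product, simp only: sum_distrib_left mult.assoc)
  finally show ?thesis .
qed

text \<open>Orthonormality reduces the squared norms of \<open>X\<close> and \<open>Y\<close> to sums of squares; only the
  mixed term sees how the two systems of singular vectors lie to each other. The lemma is used for
  \<open>A\<close> and \<open>A + E\<close> as well as for their polar factors.\<close>

lemma frobenius_norm_diff_singular_expansions:
  fixes u v :: "'i \<Rightarrow> nat \<Rightarrow> complex" and u' v' :: "'j \<Rightarrow> nat \<Rightarrow> complex"
  assumes carr: "X \<in> carrier_mat m n" "Y \<in> carrier_mat m n" and fin: "finite I" "finite J"
    and expX: "singular_expansion m n I \<alpha> u v X" and expY: "singular_expansion m n J \<beta> u' v' Y"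
  shows "(frobenius_norm (X - Y))\<^sup>2 = (\<Sum>i\<in>I. (\<alpha> i)\<^sup>2) + (\<Sum>j\<in>J. (\<beta> j)\<^sup>2)
     - 2 * (\<Sum>i\<in>I. \<Sum>j\<in>J. \<alpha> i * \<beta> j *
        Re ((\<Sum>a<m. u i a * cnj (u' j a)) * cnj (\<Sum>b<n. v i b * cnj (v' j b))))"
proof -
  note u = orthonormal_onD[OF singular_expansionD(1)[OF expX]]
    and v = orthonormal_onD[OF singular_expansionD(2)[OF expX]]
    and u' = orthonormal_onD[OF singular_expansionD(1)[OF expY]]
    and v' = orthonormal_onD[OF singular_expansionD(2)[OF expY]]
    and X = singular_expansionD(3)[OF expX] and Y = singular_expansionD(3)[OF expY]
  let ?ip = "\<lambda>X Y. \<Sum>a<m. \<Sum>b<n. X $$ (a, b) * cnj (Y $$ (a, b))"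
  have XX: "?ip X X = of_real (\<Sum>i\<in>I. (\<alpha> i)\<^sup>2)"
  proof -
    have "?ip X X = (\<Sum>i\<in>I. \<Sum>j\<in>I. if j = i then of_real ((\<alpha> i)\<^sup>2) else 0)"
      by (subst frobenius_inner_rank_one_sums[OF X X], assumption+)
        (intro sum.cong refl, auto simp: u v power2_eq_square)
    then show ?thesis using fin by (simp add: sum.delta)
  qed
  have YY: "?ip Y Y = of_real (\<Sum>j\<in>J. (\<beta> j)\<^sup>2)"
  proof -
    have "?ip Y Y = (\<Sum>i\<in>J. \<Sum>j\<in>J. if j = i then of_real ((\<beta> i)\<^sup>2) else 0)"
      by (subst frobenius_inner_rank_one_sums[OF Y Y], assumption+)
        (intro sum.cong refl, auto simp: u' v' power2_eq_square)
    then show ?thesis using fin by (simp add: sum.delta)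
  qed
  have Re_scale: "Re (complex_of_real c * z) = c * Re z" for c z by simp
  have XY: "Re (?ip X Y) = (\<Sum>i\<in>I. \<Sum>j\<in>J. \<alpha> i * \<beta> j *
        Re ((\<Sum>a<m. u i a * cnj (u' j a)) * cnj (\<Sum>b<n. v i b * cnj (v' j b))))"
    by (subst frobenius_inner_rank_one_sums[OF X Y], assumption+) (simp only: Re_sum Re_scale)
  have sq: "(cmod (z - w))\<^sup>2 = Re (z * cnj z) + Re (w * cnj w) - 2 * Re (z * cnj w)" for z w
    unfolding cmod_power2 by (simp add: power2_eq_square algebra_simps)
  have "(frobenius_norm (X - Y))\<^sup>2 = (\<Sum>a<m. \<Sum>b<n. (cmod (X $$ (a, b) - Y $$ (a, b)))\<^sup>2)"
    using carr unfolding frobenius_norm_def by (simp add: sum_nonneg)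
  also have "\<dots> = Re (?ip X X) + Re (?ip Y Y) - 2 * Re (?ip X Y)"
    unfolding sq by (simp only: sum.distrib sum_subtractf sum_distrib_left[symmetric] Re_sum)
  finally show ?thesis unfolding XX YY XY by simp
qed

text \<open>\<open>\<bar>Re (p q)\<bar> \<le> (\<bar>p\<bar>\<^sup>2 + \<bar>q\<bar>\<^sup>2) / 2\<close>, and each of the two sums of squares is at most 1
  by Bessel's inequality.\<close>

lemma overlap_row_sum_le_1:
  fixes f g :: "'j \<Rightarrow> nat \<Rightarrow> complex"
  assumes J: "finite J" and f: "orthonormal_on m J f" and g: "orthonormal_on n J g"
    and x: "(\<Sum>a<m. x a * cnj (x a)) = 1" and y: "(\<Sum>b<n. y b * cnj (y b)) = 1"
  shows "(\<Sum>j\<in>J. \<bar>Re ((\<Sum>a<m. x a * cnj (f j a)) * cnj (\<Sum>b<n. y b * cnj (g j b)))\<bar>) \<le> 1"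
proof -
  let ?p = "\<lambda>j. \<Sum>a<m. x a * cnj (f j a)" and ?q = "\<lambda>j. \<Sum>b<n. y b * cnj (g j b)"
  have unit: "(\<Sum>a<k. (cmod (z a))\<^sup>2) = 1" if "(\<Sum>a<k. z a * cnj (z a)) = 1" for z :: "nat \<Rightarrow> complex" and k
  proof -
    have "complex_of_real (\<Sum>a<k. (cmod (z a))\<^sup>2) = complex_of_real 1"
      using that by (simp add: complex_norm_square del: of_real_power)
    then show ?thesis by (simp only: of_real_eq_iff)
  qed
  have "\<bar>Re (?p j * cnj (?q j))\<bar> \<le> ((cmod (?p j))\<^sup>2 + (cmod (?q j))\<^sup>2) / 2" for j
  proof -
    have "\<bar>Re (?p j * cnj (?q j))\<bar> \<le> cmod (?p j) * cmod (?q j)"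
      using abs_Re_le_cmod[of "?p j * cnj (?q j)"] by (simp only: norm_mult complex_mod_cnj)
    also have "\<dots> \<le> ((cmod (?p j))\<^sup>2 + (cmod (?q j))\<^sup>2) / 2"
      using sum_squares_bound[of "cmod (?p j)" "cmod (?q j)"] by simp
    finally show ?thesis .
  qed
  then have "(\<Sum>j\<in>J. \<bar>Re (?p j * cnj (?q j))\<bar>) \<le> (\<Sum>j\<in>J. ((cmod (?p j))\<^sup>2 + (cmod (?q j))\<^sup>2) / 2)"
    by (intro sum_mono)
  also have "\<dots> = ((\<Sum>j\<in>J. (cmod (?p j))\<^sup>2) + (\<Sum>j\<in>J. (cmod (?q j))\<^sup>2)) / 2"
    by (simp only: sum.distrib sum_divide_distrib[symmetric])
  also have "\<dots> \<le> (1 + 1) / 2"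
    using bessel_inequality[OF J f, of x] bessel_inequality[OF J g, of y] unit[OF x] unit[OF y]
    by (intro divide_right_mono add_mono) auto
  finally show ?thesis by simp
qed

text \<open>The square of the coefficient.\<close>

definition max_distance_ratio :: "nat \<Rightarrow> nat \<Rightarrow> (nat \<Rightarrow> real) \<Rightarrow> (nat \<Rightarrow> real) \<Rightarrow> real" where
  "max_distance_ratio r s x y =
     Max ((\<lambda>k. (real s - real r + 4 * real k) / matching_distance r s x y k) ` {0..r})"

lemma polar_coefficient_eq: "polar_coefficient r s x y = sqrt (max_distance_ratio r s x y)"
  unfolding polar_coefficient_def max_distance_ratio_def matching_distance_def ..

lemma matching_distance_nonneg: "0 \<le> matching_distance r s x y k"
  unfolding matching_distance_def by (intro add_nonneg_nonneg sum_nonneg) auto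

text \<open>This excludes quotients \<open>a / 0\<close> with \<open>a > 0\<close>, whose value 0 would not bound anything.
  Either some \<open>\<tau>\<close> is left unmatched, or some pair is matched with sign \<open>-\<close>.\<close>

lemma matching_distance_pos:
  assumes "r \<le> s" "k \<le> r" "\<And>j. j \<in> {1..r} \<Longrightarrow> 0 < x j" "\<And>j. j \<in> {1..s} \<Longrightarrow> 0 < y j"
    and "0 < real s - real r + 4 * real k"
  shows "0 < matching_distance r s x y k"
proof (cases "k = 0")
  case True
  then have "r < s" using assms by simp
  then have "0 < (\<Sum>j=r-k+1..s-k. (y j)\<^sup>2)"
    using True by (intro sum_pos zero_less_power assms(4)) auto
  then show ?thesis
    unfolding matching_distance_def by (intro add_nonneg_pos add_nonneg_nonneg sum_nonneg) auto
next
  case False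
  have pos: "0 < x (r + 1 - j) + y (s - k + j)" if "j \<in> {1..k}" for j
    using that assms(1,2) by (intro add_pos_pos assms(3,4)) auto
  have "0 < (\<Sum>j=1..k. (x (r+1-j) + y (s-k+j))\<^sup>2)"
    using False by (intro sum_pos zero_less_power pos) auto
  then show ?thesis
    unfolding matching_distance_def by (intro add_nonneg_pos add_pos_nonneg sum_nonneg) auto
qed

lemma le_max_distance_ratio_mult:
  assumes "r \<le> s" "k \<le> r" "\<And>j. j \<in> {1..r} \<Longrightarrow> 0 < x j" "\<And>j. j \<in> {1..s} \<Longrightarrow> 0 < y j"
  shows "real s - real r + 4 * real k \<le> max_distance_ratio r s x y * matching_distance r s x y k"
    and "0 \<le> max_distance_ratio r s x y"
proof -
  let ?q = "\<lambda>k. (real s - real r + 4 * real k) / matching_distance r s x y k"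
  have le: "?q k \<le> max_distance_ratio r s x y"
    unfolding max_distance_ratio_def using assms(2) by (intro Max_ge) auto
  have "0 \<le> ?q k" using assms(1) matching_distance_nonneg by (intro divide_nonneg_nonneg) auto
  with le show M: "0 \<le> max_distance_ratio r s x y" by linarith
  show "real s - real r + 4 * real k \<le> max_distance_ratio r s x y * matching_distance r s x y k"
  proof (cases "0 < real s - real r + 4 * real k")
    case True
    then have "0 < matching_distance r s x y k" by (intro matching_distance_pos assms)
    with le show ?thesis by (simp add: pos_divide_le_eq)
  next
    case False
    moreover have "0 \<le> max_distance_ratio r s x y * matching_distance r s x y k"
      using M matching_distance_nonneg by (rule mult_nonneg_nonneg)
    ultimately show ?thesis by linarith
  qed
qed

lemma positive_nonincreasingD:
  assumes "positive_nonincreasing r x"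
  shows "\<And>i. 1 \<le> i \<Longrightarrow> i < r \<Longrightarrow> x (Suc i) \<le> x i" "\<And>i. i \<in> {1..r} \<Longrightarrow> 0 < x i"
  using assms unfolding positive_nonincreasing_def by auto

text \<open>The overlaps of the two systems of singular vectors satisfy the assumptions of
  \<open>substochastic_ratio_bound\<close>: row sums by Bessel's inequality for the singular vectors of
  \<open>A + E\<close>, column sums by the same inequality with the two systems exchanged.\<close>

lemma polar_factor_perturbation_bound:
  assumes rs: "1 \<le> r" "r \<le> s" and mono: "positive_nonincreasing r \<sigma>" "positive_nonincreasing s \<tau>"
    and A: "A \<in> carrier_mat m n" and E: "E \<in> carrier_mat m n"
    and sv: "has_nonzero_singular_values A r \<sigma>" "has_nonzero_singular_values (A + E) s \<tau>"
    and gpd: "generalized_polar_decomposition A Q H" "generalized_polar_decomposition (A + E) Q' H'"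
  shows "frobenius_norm (Q - Q') \<le> polar_coefficient r s \<sigma> \<tau> * frobenius_norm E"
proof -
  note pos = positive_nonincreasingD(2)[OF mono(1)] positive_nonincreasingD(2)[OF mono(2)]
  have AE: "A + E \<in> carrier_mat m n" using A E by simp
  have Q: "Q \<in> carrier_mat m n" "Q' \<in> carrier_mat m n"
    using gpd A AE E unfolding generalized_polar_decomposition_def Let_def rank_mats_def by auto
  obtain u v where expA: "singular_expansion m n {1..r} \<sigma> u v A"
    and expQ: "singular_expansion m n {1..r} (\<lambda>_. 1) u v Q"
    using polar_decomposition_singular_expansion[OF A gpd(1) sv(1)] .
  obtain u' v' where expAE: "singular_expansion m n {1..s} \<tau> u' v' (A + E)"
    and expQ': "singular_expansion m n {1..s} (\<lambda>_. 1) u' v' Q'"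
    using polar_decomposition_singular_expansion[OF AE gpd(2) sv(2)] .
  note orth = singular_expansionD(1,2)[OF expA] and orth' = singular_expansionD(1,2)[OF expAE]
  define w where "w i j = Re ((\<Sum>a<m. u i a * cnj (u' j a)) * cnj (\<Sum>b<n. v i b * cnj (v' j b)))" for i j
  have row: "(\<Sum>j=1..s. \<bar>w i j\<bar>) \<le> 1" if "i \<in> {1..r}" for i
    unfolding w_def using that orth[THEN orthonormal_onD, of i i]
    by (intro overlap_row_sum_le_1 orth') auto
  have w_swap: "w i j = Re ((\<Sum>a<m. u' j a * cnj (u i a)) * cnj (\<Sum>b<n. v' j b * cnj (v i b)))" for i j
  proof -
    have "w i j = Re (cnj ((\<Sum>a<m. u i a * cnj (u' j a)) * cnj (\<Sum>b<n. v i b * cnj (v' j b))))"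
      by (simp only: w_def complex_cnj(1) cnj.sel)
    then show ?thesis by (simp add: mult.commute)
  qed
  have col: "(\<Sum>i=1..r. \<bar>w i j\<bar>) \<le> 1" if "j \<in> {1..s}" for j
    unfolding w_swap using that orth'[THEN orthonormal_onD, of j j]
    by (intro overlap_row_sum_le_1 orth) auto
  let ?M = "max_distance_ratio r s \<sigma> \<tau>"
  have normQ: "(frobenius_norm (Q - Q'))\<^sup>2 = real r + real s - 2 * (\<Sum>i=1..r. \<Sum>j=1..s. w i j)"
    using frobenius_norm_diff_singular_expansions[OF Q finite_atLeastAtMost finite_atLeastAtMost expQ expQ']
    by (simp add: w_def)
  have "(frobenius_norm (A - (A + E)))\<^sup>2 = (\<Sum>i=1..r. (\<sigma> i)\<^sup>2) + (\<Sum>j=1..s. (\<tau> j)\<^sup>2)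
      - 2 * (\<Sum>i=1..r. \<Sum>j=1..s. \<sigma> i * \<tau> j * w i j)"
    unfolding w_def
    by (rule frobenius_norm_diff_singular_expansions[OF A AE finite_atLeastAtMost finite_atLeastAtMost expA expAE])
  moreover have "frobenius_norm (A - (A + E)) = frobenius_norm E"
    using A E unfolding frobenius_norm_def by simp
  ultimately have normE: "(frobenius_norm E)\<^sup>2 = (\<Sum>i=1..r. (\<sigma> i)\<^sup>2) + (\<Sum>j=1..s. (\<tau> j)\<^sup>2)
      - 2 * (\<Sum>i=1..r. \<Sum>j=1..s. \<sigma> i * \<tau> j * w i j)" by simp
  have "(frobenius_norm (Q - Q'))\<^sup>2 \<le> ?M * (frobenius_norm E)\<^sup>2"
    unfolding normQ normE
  proof (rule substochastic_ratio_bound[OF rs])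
    show "real s - real r + 4 * real k \<le> ?M * matching_distance r s \<sigma> \<tau> k" if "k \<le> r" for k
      using le_max_distance_ratio_mult(1)[OF rs(2) that] pos by blast
    show "0 \<le> ?M" using le_max_distance_ratio_mult(2)[OF rs(2), of 0] pos by blast
  qed (use row col positive_nonincreasingD[OF mono(1)] positive_nonincreasingD[OF mono(2)] in \<open>auto intro: less_imp_le\<close>)
  then have "sqrt ((frobenius_norm (Q - Q'))\<^sup>2) \<le> sqrt (?M * (frobenius_norm E)\<^sup>2)"
    by (rule real_sqrt_le_mono)
  moreover have "0 \<le> frobenius_norm X" for X
    unfolding frobenius_norm_def by (intro real_sqrt_ge_zero sum_nonneg) auto
  ultimately show ?thesis
    by (simp add: real_sqrt_mult polar_coefficient_eq)
qed


section \<open>Optimality: rectangular diagonal matrices\<close>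

lemma real_diag_mat_mult_vec:
  assumes "x \<in> carrier_vec n" "a < m"
  shows "(real_diag_mat m n d *\<^sub>v x) $ a = (if a < n then complex_of_real (d a) * x $ a else 0)"
proof -
  have "(real_diag_mat m n d *\<^sub>v x) $ a = (\<Sum>b<n. real_diag_mat m n d $$ (a, b) * x $ b)"
    using assms by (simp add: scalar_prod_def atLeast0LessThan del: real_diag_mat_index)
  also have "\<dots> = (\<Sum>b<n. if a = b then complex_of_real (d b) * x $ b else 0)"
    using assms by (intro sum.cong) auto
  finally have "(real_diag_mat m n d *\<^sub>v x) $ a = \<dots>" .
  then show ?thesis by (simp add: sum.delta)
qed

lemma mat_adjoint_real_diag_mat [simp]:
  "mat_adjoint (real_diag_mat m n d) = real_diag_mat n m d"
  by (rule eq_matI) auto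

lemma real_diag_mat_mult:
  assumes "\<And>i. e i \<noteq> 0 \<Longrightarrow> i < n"
  shows "real_diag_mat m n d * real_diag_mat n k e = real_diag_mat m k (\<lambda>i. d i * e i)"
proof (rule eq_matI, goal_cases)
  case (1 i j)
  then have ij: "i < m" "j < k" by auto
  have "(real_diag_mat m n d * real_diag_mat n k e) $$ (i, j)
     = (\<Sum>l<n. real_diag_mat m n d $$ (i, l) * real_diag_mat n k e $$ (l, j))"
    using ij by (simp add: scalar_prod_def atLeast0LessThan del: real_diag_mat_index)
  also have "\<dots> = (\<Sum>l<n. if l = i then complex_of_real (d i) * (if i = j then complex_of_real (e j) else 0) else 0)"
    using ij by (intro sum.cong) auto
  also have "\<dots> = real_diag_mat m k (\<lambda>i. d i * e i) $$ (i, j)"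
    using ij assms[of i] by (auto simp: sum.delta)
  finally show ?case .
qed auto

text \<open>Only the zero pattern of the diagonal matters, and not the number of columns. This compares the ranges of
  \<open>Q\<^sup>*\<close> and \<open>H\<close>, which have different shapes.\<close>

lemma col_space_real_diag_mat:
  assumes "\<And>i. d i \<noteq> 0 \<Longrightarrow> i < n"
  shows "vec_space.col_space m (real_diag_mat m n d) =
    {y \<in> carrier_vec m. \<forall>i<m. d i = 0 \<longrightarrow> y $ i = 0}" (is "_ = ?R")
proof -
  have "\<exists>x\<in>carrier_vec n. real_diag_mat m n d *\<^sub>v x = y" if y: "y \<in> ?R" for y
  proof
    let ?x = "vec n (\<lambda>i. if i < m then y $ i / complex_of_real (d i) else 0)"
    show "?x \<in> carrier_vec n" by simp
    show "real_diag_mat m n d *\<^sub>v ?x = y"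
    proof (rule eq_vecI)
      fix i assume "i < dim_vec y"
      then have "i < m" using y by auto
      then show "(real_diag_mat m n d *\<^sub>v ?x) $ i = y $ i"
        using y assms[of i] by (subst real_diag_mat_mult_vec) auto
    qed (use y in auto)
  qed
  moreover have "real_diag_mat m n d *\<^sub>v x \<in> ?R" if "x \<in> carrier_vec n" for x
    using that by (auto simp: real_diag_mat_mult_vec intro!: carrier_vecI simp del: index_mult_mat_vec)
  ultimately show ?thesis
    unfolding vec_space.col_space_eq[OF real_diag_mat_carrier] by auto
qed

lemma rank_eq_of_col_space_eq:
  assumes "vec_space.col_space m A = vec_space.col_space m B"
  shows "vec_space.rank m A = vec_space.rank m B"
  using assms by (simp add: vec_space.rank_def vec_space.col_space_def)

text \<open>The rank depends only on the column space, so the nonzero entries may be replaced by 1. Then the nonzero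
  columns are distinct unit vectors, a maximal independent set of columns.\<close>

lemma rank_real_diag_mat:
  assumes "\<And>i. d i \<noteq> 0 \<Longrightarrow> i < m \<and> i < n"
  shows "vec_space.rank m (real_diag_mat m n d) = card {i. d i \<noteq> 0}"
proof -
  interpret vec_space "TYPE(complex)" m .
  let ?S = "{i. d i \<noteq> 0}"
  define e where "e i = (of_bool (d i \<noteq> 0) :: real)" for i
  let ?B = "real_diag_mat m n e"
  have e0: "e i = 0 \<longleftrightarrow> d i = 0" for i by (simp add: e_def)
  have "col_space (real_diag_mat m n d) = col_space ?B"
    using assms e0 by (subst (1 2) col_space_real_diag_mat) auto
  then have "rank (real_diag_mat m n d) = rank ?B" by (rule rank_eq_of_col_space_eq)
  also have "rank ?B = card (unit_vec m ` ?S :: complex vec set)"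
  proof (rule rank_card_indpt[OF real_diag_mat_carrier])
    have col: "col ?B j = (if d j \<noteq> 0 then unit_vec m j else 0\<^sub>v m)" if "j < n" for j
      using that assms[of j] by (intro eq_vecI) (auto simp: e_def)
    have cols: "set (cols ?B) = col ?B ` {..<n}"
      by (auto simp: cols_def atLeast0LessThan)
    have "unit_vec m ` ?S \<subseteq> set (unit_vecs m)"
      using assms by (auto simp: unit_vecs_def)
    then have ind: "lin_indpt (unit_vec m ` ?S)"
      using unit_vecs_basis subset_li_is_li unfolding basis_def by metis
    show "maximal (unit_vec m ` ?S) (\<lambda>T. T \<subseteq> set (cols ?B) \<and> lin_indpt T)"
      unfolding maximal_def
    proof (intro conjI allI impI ind)
      show "unit_vec m ` ?S \<subseteq> set (cols ?B)"
        unfolding cols using assms col by (force simp: image_iff)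
      fix T :: "complex vec set"
      assume T: "unit_vec m ` ?S \<subseteq> T \<and> T \<subseteq> set (cols ?B) \<and> lin_indpt T"
      have "(UNIV :: complex set) \<noteq> {0}" by (metis UNIV_I singletonD zero_neq_one)
      with T have "0\<^sub>v m \<notin> T" using zero_nin_lin_indpt[of T] cols_dim[of ?B] by auto
      moreover have "set (cols ?B) \<subseteq> insert (0\<^sub>v m) (unit_vec m ` ?S)"
        unfolding cols using col by auto
      ultimately show "T = unit_vec m ` ?S" using T by blast
    qed
  qed
  also have "\<dots> = card ?S"
    by (rule card_image) (use assms in \<open>auto simp: inj_on_def\<close>)
  finally show ?thesis .
qed

lemma subunitary_real_diag_mat:
  assumes supp: "\<And>i. e i \<noteq> 0 \<Longrightarrow> i < m \<and> i < n" and one: "\<And>i. e i \<noteq> 0 \<Longrightarrow> \<bar>e i\<bar> = 1"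
  shows "subunitary (real_diag_mat m n e)"
  unfolding subunitary_def
proof (intro ballI impI)
  let ?Q = "real_diag_mat m n e"
  fix x assume "x \<in> carrier_vec (dim_col ?Q)" and orth: "\<forall>y\<in>mat_kernel ?Q. x \<bullet>c y = 0"
  then have x: "x \<in> carrier_vec n" by simp
  have x0: "x $ i = 0" if i: "i < n" "e i = 0" for i
  proof -
    have "unit_vec n i \<in> mat_kernel ?Q"
    proof (rule mat_kernelI[OF real_diag_mat_carrier])
      show "?Q *\<^sub>v unit_vec n i = 0\<^sub>v m"
        using i by (intro eq_vecI) (auto simp: real_diag_mat_mult_vec simp del: index_mult_mat_vec)
    qed simp
    then have "x \<bullet>c unit_vec n i = 0" using orth by blast
    moreover have "x \<bullet>c unit_vec n i = (\<Sum>j<n. x $ j * cnj (unit_vec n i $ j))"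
      by (simp add: scalar_prod_def atLeast0LessThan del: index_unit_vec(1) index_unit_vec(2))
    moreover have "\<dots> = (\<Sum>j<n. if j = i then x $ j else 0)"
      using i by (intro sum.cong) auto
    ultimately show ?thesis using i by (simp add: sum.delta)
  qed
  have Qx: "(cmod ((?Q *\<^sub>v x) $ i))\<^sup>2 = (if i < n then (cmod (x $ i))\<^sup>2 else 0)" if "i < m" for i
    using that x0[of i] one[of i] supp[of i] x
    by (auto simp: real_diag_mat_mult_vec norm_mult simp del: index_mult_mat_vec)
  have "(\<Sum>i<m. (cmod ((?Q *\<^sub>v x) $ i))\<^sup>2) = (\<Sum>i<m. if i < n then (cmod (x $ i))\<^sup>2 else 0)"
    using Qx by (intro sum.cong) auto
  also have "\<dots> = (\<Sum>i\<in>{i\<in>{..<m}. i < n}. (cmod (x $ i))\<^sup>2)"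
    by (rule sum.inter_filter[symmetric]) simp
  also have "\<dots> = (\<Sum>i<n. (cmod (x $ i))\<^sup>2)"
    by (rule sum.mono_neutral_left) (use x0 supp in \<open>auto simp: linorder_not_less\<close>)
  finally show "(?Q *\<^sub>v x) \<bullet>c (?Q *\<^sub>v x) = x \<bullet>c x"
    using x by (simp add: cscalar_prod_self)
qed

lemma positive_semidefinite_real_diag_mat:
  assumes "\<And>i. 0 \<le> d i"
  shows "positive_semidefinite (real_diag_mat n n d)"
  unfolding positive_semidefinite_def
proof (intro conjI ballI)
  fix x :: "complex vec" assume "x \<in> carrier_vec (dim_row (real_diag_mat n n d))"
  then have x: "x \<in> carrier_vec n" by simp
  have "(real_diag_mat n n d *\<^sub>v x) \<bullet>c x = (\<Sum>i<n. complex_of_real (d i) * x $ i * cnj (x $ i))"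
    using x by (simp add: scalar_prod_def[of _ "conjugate x"] real_diag_mat_mult_vec atLeast0LessThan
        del: index_mult_mat_vec)
  also have "\<dots> = complex_of_real (\<Sum>i<n. d i * (cmod (x $ i))\<^sup>2)"
    by (simp add: complex_norm_square mult.assoc del: of_real_power)
  finally show "0 \<le> Re ((real_diag_mat n n d *\<^sub>v x) \<bullet>c x)"
    using assms by (auto intro!: sum_nonneg)
qed auto

text \<open>The polar decomposition of a real number, \<open>d = sgn d * \<bar>d\<bar>\<close>, in every diagonal
  entry.\<close>

lemma generalized_polar_decomposition_real_diag_mat:
  assumes supp: "\<And>i. d i \<noteq> 0 \<Longrightarrow> i < m \<and> i < n"
  shows "generalized_polar_decomposition (real_diag_mat m n d)
     (real_diag_mat m n (\<lambda>i. sgn (d i))) (real_diag_mat n n (\<lambda>i. \<bar>d i\<bar>))"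
proof -
  have n: "i < n" if "d i \<noteq> 0" for i using supp that by blast
  have m: "i < m" if "d i \<noteq> 0" for i using supp that by blast
  have "real_diag_mat m n d = real_diag_mat m n (\<lambda>i. sgn (d i)) * real_diag_mat n n (\<lambda>i. \<bar>d i\<bar>)"
    using n by (subst real_diag_mat_mult) (auto simp: sgn_mult_abs)
  moreover have "subunitary (real_diag_mat m n (\<lambda>i. sgn (d i)))"
    by (rule subunitary_real_diag_mat) (use supp in \<open>auto simp: sgn_if split: if_splits\<close>)
  moreover have "vec_space.col_space n (real_diag_mat n m (\<lambda>i. sgn (d i)))
      = vec_space.col_space n (real_diag_mat n n (\<lambda>i. \<bar>d i\<bar>))"
    using m n by (subst (1 2) col_space_real_diag_mat) (auto simp: sgn_eq_0_iff)
  moreover have "vec_space.rank m (real_diag_mat m n (\<lambda>i. sgn (d i))) = card {i. d i \<noteq> 0}"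
    "vec_space.rank n (real_diag_mat n n (\<lambda>i. \<bar>d i\<bar>)) = card {i. d i \<noteq> 0}"
    "vec_space.rank m (real_diag_mat m n d) = card {i. d i \<noteq> 0}"
    using supp by (subst rank_real_diag_mat; auto simp: sgn_eq_0_iff)+
  moreover have "positive_semidefinite (real_diag_mat n n (\<lambda>i. \<bar>d i\<bar>))"
    by (rule positive_semidefinite_real_diag_mat) simp
  ultimately show ?thesis
    unfolding generalized_polar_decomposition_def Let_def rank_mats_def by simp
qed

lemma mat_adjoint_one: "mat_adjoint (1\<^sub>m n :: complex mat) = 1\<^sub>m n"
  by (rule eq_matI) auto

lemma nonzero_singular_values_real_diag_mat:
  assumes supp: "\<And>i. d i \<noteq> 0 \<Longrightarrow> i < m \<and> i < n"
  shows "nonzero_singular_values (real_diag_mat m n d) = image_mset (\<lambda>i. \<bar>d i\<bar>) (mset_set {i. d i \<noteq> 0})"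
proof -
  have "real_diag_mat n n (\<lambda>i. d i * d i) = real_diag_mat n m d * real_diag_mat m n d"
    using supp by (subst real_diag_mat_mult) auto
  then have gram: "mat_adjoint (real_diag_mat m n d) * real_diag_mat m n d
     = 1\<^sub>m n * real_diag_mat n n (\<lambda>i. d i * d i) * mat_adjoint (1\<^sub>m n)"
    by (simp add: mat_adjoint_one)
  have "proots (char_poly (mat_adjoint (real_diag_mat m n d) * real_diag_mat m n d))
      = image_mset (\<lambda>j. complex_of_real (d j * d j)) (mset_set {..<n})"
    unfolding gram by (rule proots_char_poly_unitary_conj_real_diag) (simp_all add: mat_adjoint_one)
  then have "nonzero_singular_values (real_diag_mat m n d)
      = filter_mset (\<lambda>x. x \<noteq> 0) (image_mset (\<lambda>i. \<bar>d i\<bar>) (mset_set {..<n}))"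
    unfolding nonzero_singular_values_def by (simp add: multiset.map_comp o_def)
  also have "\<dots> = image_mset (\<lambda>i. \<bar>d i\<bar>) (mset_set {i\<in>{..<n}. d i \<noteq> 0})"
    by (simp add: filter_mset_image_mset)
  also have "{i\<in>{..<n}. d i \<noteq> 0} = {i. d i \<noteq> 0}" using supp by auto
  finally show ?thesis .
qed

lemma frobenius_norm_real_diag_mat:
  assumes supp: "\<And>i. d i \<noteq> 0 \<Longrightarrow> i < s" and s: "s \<le> min m n"
  shows "frobenius_norm (real_diag_mat m n d) = sqrt (\<Sum>i<s. (d i)\<^sup>2)"
proof -
  have z: "d i = 0" if "s \<le> i" for i by (metis supp not_le that)
  have "(\<Sum>i<m. \<Sum>j<n. (cmod (real_diag_mat m n d $$ (i, j)))\<^sup>2) = (\<Sum>i<m. \<Sum>j<n. if j = i then (d i)\<^sup>2 else 0)"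
    by (intro sum.cong) auto
  also have "\<dots> = (\<Sum>i<m. if i < n then (d i)\<^sup>2 else 0)" by (simp add: sum.delta)
  also have "\<dots> = (\<Sum>i<s. (d i)\<^sup>2)"
    by (rule sum.mono_neutral_cong_right) (use z s in auto)
  finally show ?thesis unfolding frobenius_norm_def by simp
qed

text \<open>The diagonal, with entries counted from 1, of the perturbed matrix when \<open>\<sigma>\<close> is the diagonal
  of \<open>A\<close>: it places every \<open>\<tau>\<close> in the row of the \<open>\<sigma>\<close> with which the signed
  matching pairs it, with the sign of the pair, and the unmatched ones behind.\<close>

definition extremal_diagonal :: "nat \<Rightarrow> nat \<Rightarrow> (nat \<Rightarrow> real) \<Rightarrow> nat \<Rightarrow> nat \<Rightarrow> real" where
  "extremal_diagonal r s y k p =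
     (if p \<le> r - k then y p
      else if p \<le> r then - y (r + s + 1 - k - p)
      else y (p - k))"

text \<open>The three blocks are the pairs with sign \<open>+\<close>, the pairs with sign \<open>-\<close> and the
  unmatched entries, in the order of the three sums in the denominator of the coefficient.\<close>

lemma sum_split_at_matching:
  fixes g :: "nat \<Rightarrow> real"
  assumes "r \<le> s" "k \<le> r"
  shows "(\<Sum>p=1..s. g p) = (\<Sum>p=1..r-k. g p) + (\<Sum>j=1..k. g (r + 1 - j)) + (\<Sum>j=r-k+1..s-k. g (j + k))"
proof -
  have "{1..s} = {1..r-k} \<union> {r-k+1..r} \<union> {r+1..s}" using assms by auto
  then have "(\<Sum>p=1..s. g p) = (\<Sum>p=1..r-k. g p) + (\<Sum>p=r-k+1..r. g p) + (\<Sum>p=r+1..s. g p)"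
    using assms by (simp only:) (subst sum.union_disjoint, force, force, force, simp add: sum.union_disjoint)
  also have "(\<Sum>p=r-k+1..r. g p) = (\<Sum>j=1..k. g (r + 1 - j))"
    by (rule sum.reindex_bij_witness[of _ "\<lambda>j. r + 1 - j" "\<lambda>i. r + 1 - i"]) (use assms in auto)
  also have "(\<Sum>p=r+1..s. g p) = (\<Sum>j=r-k+1..s-k. g (j + k))"
    by (rule sum.reindex_bij_witness[of _ "\<lambda>j. j + k" "\<lambda>i. i - k"]) (use assms in auto)
  finally show ?thesis .
qed

text \<open>The signs agree for the first \<open>r - k\<close> entries, are opposite for the next \<open>k\<close>, which
  contribute 4 each, and meet a zero entry of \<open>A\<close> for the last \<open>s - r\<close>, which contribute 1
  each.\<close>

lemma extremal_diagonal_distances: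
  assumes rs: "r \<le> s" "k \<le> r" and pos: "\<And>j. j \<in> {1..r} \<Longrightarrow> 0 < x j" "\<And>j. j \<in> {1..s} \<Longrightarrow> 0 < y j"
  defines "x0 \<equiv> \<lambda>p. if p \<le> r then x p else 0" and "z \<equiv> extremal_diagonal r s y k"
  shows "(\<Sum>p=1..s. (z p - x0 p)\<^sup>2) = matching_distance r s x y k"
    and "(\<Sum>p=1..s. (sgn (x0 p) - sgn (z p))\<^sup>2) = real s - real r + 4 * real k"
proof -
  have 1: "z p = y p" "x0 p = x p" if "p \<in> {1..r-k}" for p
    using that by (auto simp: z_def x0_def extremal_diagonal_def)
  have 2: "z (r + 1 - j) = - y (s - k + j)" "x0 (r + 1 - j) = x (r + 1 - j)" if "j \<in> {1..k}" for j
    using that rs by (auto simp: z_def x0_def extremal_diagonal_def intro!: arg_cong[where f = y])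
  have 3: "z (j + k) = y j" "x0 (j + k) = 0" if "j \<in> {r-k+1..s-k}" for j
    using that rs by (auto simp: z_def x0_def extremal_diagonal_def)
  show "(\<Sum>p=1..s. (z p - x0 p)\<^sup>2) = matching_distance r s x y k"
    unfolding sum_split_at_matching[OF rs] matching_distance_def
    by (intro arg_cong2[where f = "(+)"] sum.cong refl)
      (simp_all only: 1 2 3, simp_all add: power2_commute power2_eq_square algebra_simps)
  have "(\<Sum>p=1..s. (sgn (x0 p) - sgn (z p))\<^sup>2) = (\<Sum>p=1..r-k. 0) + (\<Sum>j=1..k. 4) + (\<Sum>j=r-k+1..s-k. 1)"
    unfolding sum_split_at_matching[OF rs]
  proof (intro arg_cong2[where f = "(+)"] sum.cong refl)
    fix p assume p: "p \<in> {1..r-k}"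
    then have "0 < x p" "0 < y p" using pos rs by auto
    then show "(sgn (x0 p) - sgn (z p))\<^sup>2 = 0" by (simp add: 1[OF p])
  next
    fix j assume j: "j \<in> {1..k}"
    then have "0 < x (r + 1 - j)" "0 < y (s - k + j)" using rs by (auto intro!: pos)
    then show "(sgn (x0 (r + 1 - j)) - sgn (z (r + 1 - j)))\<^sup>2 = 4"
      unfolding 2[OF j] by (simp add: sgn_minus)
  next
    fix j assume j: "j \<in> {r-k+1..s-k}"
    then have "0 < y j" using rs by (auto intro!: pos)
    then show "(sgn (x0 (j + k)) - sgn (z (j + k)))\<^sup>2 = 1" unfolding 3[OF j] by simp
  qed
  then show "(\<Sum>p=1..s. (sgn (x0 p) - sgn (z p))\<^sup>2) = real s - real r + 4 * real k"
    using rs by (simp add: of_nat_diff)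
qed

lemma extremal_diagonal_values:
  assumes rs: "r \<le> s" "k \<le> r"
  obtains h where "bij_betw h {1..s} {1..s}"
    "\<And>p. p \<in> {1..s} \<Longrightarrow> \<bar>extremal_diagonal r s y k p\<bar> = \<bar>y (h p)\<bar>"
proof
  let ?h = "\<lambda>p. if p \<le> r - k then p else if p \<le> r then r + s + 1 - k - p else p - k"
  let ?h' = "\<lambda>j. if j \<le> r - k then j else if j \<le> s - k then j + k else r + s + 1 - k - j"
  show "bij_betw ?h {1..s} {1..s}"
    by (rule bij_betwI[of _ _ _ ?h']) (use rs in auto)
  show "\<And>p. p \<in> {1..s} \<Longrightarrow> \<bar>extremal_diagonal r s y k p\<bar> = \<bar>y (?h p)\<bar>"
    by (auto simp: extremal_diagonal_def)
qed

text \<open>Matrix entries are counted from 0 and singular values from 1, whence the shift by one. The permutation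
  \<open>h\<close> is there because the diagonal need not be sorted.\<close>

lemma real_diag_mat_has_nonzero_singular_values:
  assumes s: "s \<le> min m n" and supp: "\<And>i. d i \<noteq> 0 \<longleftrightarrow> i < s"
    and h: "bij_betw h {1..s} {1..s}" "\<And>p. p \<in> {1..s} \<Longrightarrow> \<bar>d (p - 1)\<bar> = x (h p)"
  shows "real_diag_mat m n d \<in> rank_mats s m n"
    and "has_nonzero_singular_values (real_diag_mat m n d) s x"
proof -
  have S: "{i. d i \<noteq> 0} = {..<s}" using supp by auto
  have mn: "i < m \<and> i < n" if "d i \<noteq> 0" for i using that supp[of i] s by auto
  show "real_diag_mat m n d \<in> rank_mats s m n"
    using rank_real_diag_mat[of d m n, OF mn] S by (simp add: rank_mats_def)
  have "nonzero_singular_values (real_diag_mat m n d) = image_mset (\<lambda>i. \<bar>d i\<bar>) (mset_set {..<s})"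
    using nonzero_singular_values_real_diag_mat[of d m n, OF mn] S by simp
  also have "{..<s} = (\<lambda>p. p - 1) ` {1..s}"
    by (force simp: image_iff intro!: bexI[of _ "Suc _"])
  also have "mset_set \<dots> = image_mset (\<lambda>p. p - 1) (mset_set {1..s})"
    by (rule image_mset_mset_set[symmetric]) (auto simp: inj_on_def)
  also have "image_mset (\<lambda>i. \<bar>d i\<bar>) \<dots> = image_mset (\<lambda>p. x (h p)) (mset_set {1..s})"
    unfolding multiset.map_comp o_def by (rule image_mset_cong) (use h(2) in auto)
  also have "\<dots> = image_mset x (image_mset h (mset_set {1..s}))"
    by (simp add: multiset.map_comp o_def)
  also have "image_mset h (mset_set {1..s}) = mset_set {1..s}"
    using h(1) by (simp add: bij_betw_def image_mset_mset_set)
  finally show "has_nonzero_singular_values (real_diag_mat m n d) s x"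
    unfolding has_nonzero_singular_values_def .
qed

text \<open>Every quotient in the coefficient, and not only the largest one, is
  \<open>\<parallel>Q - Q'\<parallel>\<^sup>2 / \<parallel>E\<parallel>\<^sup>2\<close> for some pair of diagonal matrices with the prescribed singular
  values.\<close>

lemma polar_factor_perturbation_attained:
  assumes rs: "r \<le> s" and s: "s \<le> min m n" and k: "k \<le> r"
    and pos: "\<And>j. j \<in> {1..r} \<Longrightarrow> 0 < \<sigma> j" "\<And>j. j \<in> {1..s} \<Longrightarrow> 0 < \<tau> j"
  obtains A E Q H Q' H' where
    "A \<in> rank_mats r m n" "E \<in> carrier_mat m n" "A + E \<in> rank_mats s m n"
    "has_nonzero_singular_values A r \<sigma>" "has_nonzero_singular_values (A + E) s \<tau>"
    "generalized_polar_decomposition A Q H" "generalized_polar_decomposition (A + E) Q' H'"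
    "frobenius_norm (Q - Q') = sqrt (real s - real r + 4 * real k)"
    "frobenius_norm E = sqrt (matching_distance r s \<sigma> \<tau> k)"
proof -
  define x0 where "x0 p = (if p \<le> r then \<sigma> p else 0)" for p
  define z where "z = extremal_diagonal r s \<tau> k"
  define a where "a i = x0 (Suc i)" for i
  define b where "b i = (if i < s then z (Suc i) else 0)" for i
  let ?A = "real_diag_mat m n a" and ?E = "real_diag_mat m n (\<lambda>i. b i - a i)"
  have AE: "?A + ?E = real_diag_mat m n b" by (rule eq_matI) auto
  obtain h where h: "bij_betw h {1..s} {1..s}" "\<And>p. p \<in> {1..s} \<Longrightarrow> \<bar>z p\<bar> = \<bar>\<tau> (h p)\<bar>"
    using extremal_diagonal_values[OF rs k] unfolding z_def by metis
  have hz: "\<bar>z p\<bar> = \<tau> (h p)" "z p \<noteq> 0" if "p \<in> {1..s}" for p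
  proof -
    have "0 < \<tau> (h p)" using bij_betwE[OF h(1)] that pos(2) by blast
    then show "\<bar>z p\<bar> = \<tau> (h p)" "z p \<noteq> 0" using h(2)[OF that] by auto
  qed
  have a0: "a i \<noteq> 0 \<longleftrightarrow> i < r" for i
    using pos(1)[of "Suc i"] by (auto simp: a_def x0_def)
  have b0: "b i \<noteq> 0 \<longleftrightarrow> i < s" for i
    using hz(2)[of "Suc i"] by (auto simp: b_def)
  have ab0: "i < s" if "b i - a i \<noteq> 0" for i
    using that a0[of i] b0[of i] rs by (cases "i < s") auto
  have sgn0: "i < s" if "sgn (a i) - sgn (b i) \<noteq> 0" for i
    using that a0[of i] b0[of i] rs by (cases "i < s") auto
  have amn: "i < m \<and> i < n" if "a i \<noteq> 0" for i using that a0[of i] rs s by auto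
  have bmn: "i < m \<and> i < n" if "b i \<noteq> 0" for i using that b0[of i] s by auto
  have shift: "(\<Sum>i<s. g (a i) (b i)) = (\<Sum>p=1..s. g (x0 p) (z p))" for g :: "real \<Rightarrow> real \<Rightarrow> real"
    by (simp only: One_nat_def sum.atLeast1_atMost_eq) (auto simp: a_def b_def intro!: sum.cong)
  note dist = extremal_diagonal_distances[where x = \<sigma> and y = \<tau>, OF rs k pos, folded x0_def z_def]
  show thesis
  proof (rule that[of ?A ?E "real_diag_mat m n (\<lambda>i. sgn (a i))" "real_diag_mat n n (\<lambda>i. \<bar>a i\<bar>)"
        "real_diag_mat m n (\<lambda>i. sgn (b i))" "real_diag_mat n n (\<lambda>i. \<bar>b i\<bar>)"])
    have r: "r \<le> min m n" using rs s by simp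
    have ah: "\<bar>a (p - 1)\<bar> = \<sigma> (id p)" if "p \<in> {1..r}" for p
      using that pos(1)[OF that] by (auto simp: a_def x0_def)
    show "?A \<in> rank_mats r m n" "has_nonzero_singular_values ?A r \<sigma>"
      using real_diag_mat_has_nonzero_singular_values[OF r a0 bij_betw_id ah] by blast+
    have bh: "\<bar>b (p - 1)\<bar> = \<tau> (h p)" if "p \<in> {1..s}" for p
      using that hz(1)[OF that] by (auto simp: b_def)
    show "?A + ?E \<in> rank_mats s m n" "has_nonzero_singular_values (?A + ?E) s \<tau>"
      unfolding AE using real_diag_mat_has_nonzero_singular_values[OF s b0 h(1) bh] by blast+
    show "?E \<in> carrier_mat m n" by simp
    show "generalized_polar_decomposition ?A (real_diag_mat m n (\<lambda>i. sgn (a i))) (real_diag_mat n n (\<lambda>i. \<bar>a i\<bar>))"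
      using amn by (rule generalized_polar_decomposition_real_diag_mat)
    show "generalized_polar_decomposition (?A + ?E) (real_diag_mat m n (\<lambda>i. sgn (b i))) (real_diag_mat n n (\<lambda>i. \<bar>b i\<bar>))"
      unfolding AE using bmn by (rule generalized_polar_decomposition_real_diag_mat)
    have "real_diag_mat m n (\<lambda>i. sgn (a i)) - real_diag_mat m n (\<lambda>i. sgn (b i))
        = real_diag_mat m n (\<lambda>i. sgn (a i) - sgn (b i))"
      by (rule eq_matI) auto
    then show "frobenius_norm (real_diag_mat m n (\<lambda>i. sgn (a i)) - real_diag_mat m n (\<lambda>i. sgn (b i)))
        = sqrt (real s - real r + 4 * real k)"
      using frobenius_norm_real_diag_mat[where d = "\<lambda>i. sgn (a i) - sgn (b i)", OF sgn0 s] shift[of "\<lambda>x z. (sgn x - sgn z)\<^sup>2"] dist(2) by simp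
    show "frobenius_norm ?E = sqrt (matching_distance r s \<sigma> \<tau> k)"
      using frobenius_norm_real_diag_mat[where d = "\<lambda>i. b i - a i", OF ab0 s] shift[of "\<lambda>x z. (z - x)\<^sup>2"] dist(1) by simp
  qed
qed

theorem theorem1p3:
  fixes m n r s :: nat and \<sigma> \<tau> :: "nat \<Rightarrow> real"
  assumes "1 \<le> r" and "r \<le> s"
    and "positive_nonincreasing r \<sigma>" and "positive_nonincreasing s \<tau>"
  shows
    "(\<forall>A E Q H Q' H'.
        A \<in> rank_mats r m n \<and> E \<in> carrier_mat m n \<and> A + E \<in> rank_mats s m n \<and>
        has_nonzero_singular_values A r \<sigma> \<and> has_nonzero_singular_values (A + E) s \<tau> \<and>
        generalized_polar_decomposition A Q H \<and> generalized_polar_decomposition (A + E) Q' H'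
        \<longrightarrow> frobenius_norm (Q - Q') \<le> polar_coefficient r s \<sigma> \<tau> * frobenius_norm E) \<and>
     (s \<le> min m n \<longrightarrow>
        \<not> (\<exists>c. 0 \<le> c \<and> c < polar_coefficient r s \<sigma> \<tau> \<and>
          (\<forall>A E Q H Q' H'.
             A \<in> rank_mats r m n \<and> E \<in> carrier_mat m n \<and> A + E \<in> rank_mats s m n \<and>
             has_nonzero_singular_values A r \<sigma> \<and> has_nonzero_singular_values (A + E) s \<tau> \<and>
             generalized_polar_decomposition A Q H \<and> generalized_polar_decomposition (A + E) Q' H'
             \<longrightarrow> frobenius_norm (Q - Q') \<le> c * frobenius_norm E)))"
proof (intro conjI allI impI notI)
  fix A E Q H Q' H'
  assume "A \<in> rank_mats r m n \<and> E \<in> carrier_mat m n \<and> A + E \<in> rank_mats s m n \<and>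
        has_nonzero_singular_values A r \<sigma> \<and> has_nonzero_singular_values (A + E) s \<tau> \<and>
        generalized_polar_decomposition A Q H \<and> generalized_polar_decomposition (A + E) Q' H'"
  then show "frobenius_norm (Q - Q') \<le> polar_coefficient r s \<sigma> \<tau> * frobenius_norm E"
    by (intro polar_factor_perturbation_bound[OF assms, of A m n E Q H Q' H']) (auto simp: rank_mats_def)
next
  assume s: "s \<le> min m n"
  assume "\<exists>c. 0 \<le> c \<and> c < polar_coefficient r s \<sigma> \<tau> \<and>
          (\<forall>A E Q H Q' H'.
             A \<in> rank_mats r m n \<and> E \<in> carrier_mat m n \<and> A + E \<in> rank_mats s m n \<and>
             has_nonzero_singular_values A r \<sigma> \<and> has_nonzero_singular_values (A + E) s \<tau> \<and>
             generalized_polar_decomposition A Q H \<and> generalized_polar_decomposition (A + E) Q' H'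
             \<longrightarrow> frobenius_norm (Q - Q') \<le> c * frobenius_norm E)"
  then obtain c where c: "0 \<le> c" "c < polar_coefficient r s \<sigma> \<tau>"
    and bound: "\<And>A E Q H Q' H'. A \<in> rank_mats r m n \<Longrightarrow> E \<in> carrier_mat m n \<Longrightarrow> A + E \<in> rank_mats s m n \<Longrightarrow>
             has_nonzero_singular_values A r \<sigma> \<Longrightarrow> has_nonzero_singular_values (A + E) s \<tau> \<Longrightarrow>
             generalized_polar_decomposition A Q H \<Longrightarrow> generalized_polar_decomposition (A + E) Q' H'
             \<Longrightarrow> frobenius_norm (Q - Q') \<le> c * frobenius_norm E"
    by blast
  let ?q = "\<lambda>k. (real s - real r + 4 * real k) / matching_distance r s \<sigma> \<tau> k"
  have "max_distance_ratio r s \<sigma> \<tau> \<in> ?q ` {0..r}"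
    unfolding max_distance_ratio_def by (rule Max_in) auto
  then obtain k where k: "k \<le> r" "max_distance_ratio r s \<sigma> \<tau> = ?q k" by auto
  obtain A E Q H Q' H' where ex:
    "A \<in> rank_mats r m n" "E \<in> carrier_mat m n" "A + E \<in> rank_mats s m n"
    "has_nonzero_singular_values A r \<sigma>" "has_nonzero_singular_values (A + E) s \<tau>"
    "generalized_polar_decomposition A Q H" "generalized_polar_decomposition (A + E) Q' H'"
    and N: "frobenius_norm (Q - Q') = sqrt (real s - real r + 4 * real k)"
    and D: "frobenius_norm E = sqrt (matching_distance r s \<sigma> \<tau> k)"
    using polar_factor_perturbation_attained[OF assms(2) s k(1)
        positive_nonincreasingD(2)[OF assms(3)] positive_nonincreasingD(2)[OF assms(4)]] .
  have le: "sqrt (real s - real r + 4 * real k) \<le> c * sqrt (matching_distance r s \<sigma> \<tau> k)"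
    using bound[OF ex] unfolding N D .
  have coeff: "polar_coefficient r s \<sigma> \<tau> =
      sqrt (real s - real r + 4 * real k) / sqrt (matching_distance r s \<sigma> \<tau> k)"
    unfolding polar_coefficient_eq k(2) by (rule real_sqrt_divide)
  \<comment> \<open>A vanishing denominator would make the coefficient 0, which no nonnegative c is below.\<close>
  with c have "sqrt (matching_distance r s \<sigma> \<tau> k) \<noteq> 0" by auto
  then have "0 < sqrt (matching_distance r s \<sigma> \<tau> k)"
    using matching_distance_nonneg[of r s \<sigma> \<tau> k] by simp
  with le have "polar_coefficient r s \<sigma> \<tau> \<le> c" unfolding coeff by (simp add: pos_divide_le_eq)
  with c show False by simp
qed

end
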